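(* Let $K$ be a field, let $A\subset K[x_1,\dots,x_n]$ be a toric ring whose minimal monomial generators all have the same degree $d$, and let $B\subset A$ be a combinatorial pure subring. Then $A$ and $B$ are naturally standard graded, and $$\beta_{i,j}(B)\le\beta_{i,j}(A)\quad\text{for all } i \text{ and } j.$$
   Context: A toric ring $A=K[u_1,\dots,u_m]\subset K[x_1,\dots,x_n]$ is a $K$-subalgebra minimally generated by finitely many monomials $u_1,\dots,u_m$. A $K$-subalgebra $B$ of $A$ is called a combinatorial pure subring of $A$ if there is a subset $T\subset[n]=\{1,\dots,n\}$ with $B=A\cap K[x_i: i\in T]$; then $B$ is the toric ring generated by those $u_k$ that involve only variables $x_i$ with $i\in T$. When all $u_k$ have degree $d\ge 1$, the natural standard grading gives a monomial of $A$ of total degree $dj$ in the variables $x_1,\dots,x_n$ the degree $j$, so each $u_k$ has degree $1$; likewise for $B$. For such a standard graded toric ring $A$ with minimal monomial generators $u_1,\dots,u_m$, the graded Betti numbers are $\beta_{i,j}(A)=\dim_K\operatorname{Tor}_i^P(A,K)_j$, where $P=K[t_1,\dots,t_m]$ is the standard graded polynomial ring and $A$ is a $P$-module via $t_k\mapsto u_k$. The numbers $\beta_{i,j}(B)$ are defined in the same way over the polynomial ring in as many variables as $B$ has minimal monomial generators. *)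

theory Defs
  imports Complex_Main "HOL-Library.Poly_Mapping"
begin

section \<open>Polynomials, subalgebras and gradings\<close>

type_synonym 'x monomial = "'x \<Rightarrow>\<^sub>0 nat"
type_synonym ('x, 'k) mpoly = "'x monomial \<Rightarrow>\<^sub>0 'k"

abbreviation coef :: "('a \<Rightarrow>\<^sub>0 'b::zero) \<Rightarrow> 'a \<Rightarrow> 'b"
  where "coef \<equiv> Poly_Mapping.lookup"

abbreviation supp :: "('a \<Rightarrow>\<^sub>0 'b::zero) \<Rightarrow> 'a set"
  where "supp \<equiv> Poly_Mapping.keys"

definition mon_degree :: "'x monomial \<Rightarrow> nat"
  where "mon_degree w = (\<Sum>x\<in>supp w. coef w x)"

definition const_poly :: "'k \<Rightarrow> ('x, 'k::zero) mpoly"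
  where "const_poly c = Poly_Mapping.single 0 c"

definition mon_poly :: "'x monomial \<Rightarrow> ('x, 'k::zero_neq_one) mpoly"
  where "mon_poly w = Poly_Mapping.single w 1"

text \<open>The polynomial ring in the variables indexed by \<open>X\<close>.\<close>

definition poly_ring :: "'x set \<Rightarrow> ('x, 'k::zero) mpoly set"
  where "poly_ring X = {p. \<forall>w\<in>supp p. supp w \<subseteq> X}"

definition is_subalgebra :: "('x, 'k::field) mpoly set \<Rightarrow> bool"
  where "is_subalgebra A \<longleftrightarrow> range const_poly \<subseteq> A \<and>
    (\<forall>f\<in>A. \<forall>g\<in>A. f + g \<in> A \<and> f * g \<in> A)"

text \<open>
  Coefficientwise scaling. It serves for the \<open>K\<close>-vector spaces of polynomials, for
  the \<open>K\<close>-vector spaces with a given basis, and for free modules over a polynomial ring.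
\<close>

definition pscale :: "'b::mult_zero \<Rightarrow> ('a \<Rightarrow>\<^sub>0 'b) \<Rightarrow> ('a \<Rightarrow>\<^sub>0 'b)"
  where "pscale c f = Poly_Mapping.map ((*) c) f"

lemma lookup_pscale: "coef (pscale c f) a = c * coef f a"
  by (simp add: pscale_def map.rep_eq when_def)

lemma vector_space_pscale:
  "vector_space (pscale :: 'k::field \<Rightarrow> ('a \<Rightarrow>\<^sub>0 'k) \<Rightarrow> _)"
  by unfold_locales
    (simp_all add: poly_mapping_eq_iff fun_eq_iff lookup_pscale lookup_add algebra_simps)

text \<open>
  \<open>G\<close> makes the commutative \<open>K\<close>-algebra \<open>A\<close> a standard graded one:
  \<open>A\<close> is the direct sum of the subspaces \<open>G j\<close>, products respect degrees, \<open>G 0 = K\<close>, and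
  \<open>A\<close> is generated by the finite-dimensional space \<open>G 1\<close>.
\<close>

definition standard_graded ::
  "('x, 'k::field) mpoly set \<Rightarrow> (nat \<Rightarrow> ('x, 'k) mpoly set) \<Rightarrow> bool"
  where "standard_graded A G \<longleftrightarrow>
    is_subalgebra A \<and>
    (\<forall>j. module.subspace pscale (G j) \<and> G j \<subseteq> A) \<and>
    (\<forall>f\<in>A. \<exists>!h :: nat \<Rightarrow>\<^sub>0 ('x, 'k) mpoly.
       (\<forall>j. coef h j \<in> G j) \<and> f = (\<Sum>j\<in>supp h. coef h j)) \<and>
    (\<forall>i j. \<forall>f\<in>G i. \<forall>g\<in>G j. f * g \<in> G (i + j)) \<and>
    G 0 = range const_poly \<and>
    (\<exists>S. finite S \<and> G 1 = module.span pscale S) \<and>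
    is_subalgebra hull (G 1) = A"

section \<open>Toric rings\<close>

definition minimally_generates ::
  "'x monomial set \<Rightarrow> ('x, 'k::field) mpoly set \<Rightarrow> bool"
  where "minimally_generates U A \<longleftrightarrow>
    is_subalgebra hull (mon_poly ` U) = A \<and>
    (\<forall>V. V \<subset> U \<longrightarrow> is_subalgebra hull (mon_poly ` V) \<noteq> A)"

definition toric_ring :: "nat \<Rightarrow> (nat, 'k::field) mpoly set \<Rightarrow> bool"
  where "toric_ring n A \<longleftrightarrow>
    A \<subseteq> poly_ring {1..n} \<and> (\<exists>U. finite U \<and> minimally_generates U A)"

text \<open>
  The minimal monomial generators of a toric ring, as exponent vectors; they are uniquely
  determined by the ring, being the irreducible elements of its monoid of monomials.
\<close>

definition min_gens :: "('x, 'k::field) mpoly set \<Rightarrow> 'x monomial set"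
  where "min_gens A = (THE U. finite U \<and> minimally_generates U A)"

definition combinatorial_pure_subring ::
  "nat \<Rightarrow> (nat, 'k::field) mpoly set \<Rightarrow> (nat, 'k) mpoly set \<Rightarrow> bool"
  where "combinatorial_pure_subring n A B \<longleftrightarrow>
    (\<exists>T \<subseteq> {1..n}. B = A \<inter> poly_ring T)"

text \<open>The natural grading for generators of degree \<open>d\<close>: total degree divided by \<open>d\<close>.\<close>

definition toric_grading ::
  "nat \<Rightarrow> ('x, 'k::zero) mpoly set \<Rightarrow> nat \<Rightarrow> ('x, 'k) mpoly set"
  where "toric_grading d A j = {f \<in> A. \<forall>w\<in>supp f. mon_degree w = d * j}"

section \<open>Graded free resolutions and Tor\<close>

text \<open>
  Throughout, \<open>P = poly_ring X\<close> carries the standard grading and acts on a set \<open>M\<close> of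
  polynomials through the substitution \<open>t\<^sub>v \<mapsto> g v\<close>.
\<close>

definition poly_subst ::
  "('v \<Rightarrow> ('x, 'k::field) mpoly) \<Rightarrow> ('v, 'k) mpoly \<Rightarrow> ('x, 'k) mpoly"
  where "poly_subst g p =
    (\<Sum>s\<in>supp p. const_poly (coef p s) * (\<Prod>v\<in>supp s. g v ^ coef s v))"

text \<open>
  A complex \<open>\<dots> \<rightarrow> F\<^sub>2 \<rightarrow> F\<^sub>1 \<rightarrow> F\<^sub>0 \<rightarrow> M\<close> with each \<open>F\<^sub>i\<close> free on a basis indexed by
  \<open>gbasis C i\<close>, whose element \<open>k\<close> has degree \<open>gdeg C i k\<close>. The differential
  \<open>F\<^bsub>i+1\<^esub> \<rightarrow> F\<^sub>i\<close> sends basis element \<open>k\<close> to \<open>gdiff C i k\<close>, and \<open>F\<^sub>0 \<rightarrow> M\<close> sends \<open>k\<close> to \<open>gaug C k\<close>.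
\<close>

record (overloaded) ('v, 'x, 'k) free_complex =
  gbasis :: "nat \<Rightarrow> nat set"
  gdeg :: "nat \<Rightarrow> nat \<Rightarrow> nat"
  gdiff :: "nat \<Rightarrow> nat \<Rightarrow> nat \<Rightarrow>\<^sub>0 ('v, 'k) mpoly"
  gaug :: "nat \<Rightarrow> ('x, 'k) mpoly"

definition free_mod :: "'v set \<Rightarrow> nat set \<Rightarrow> (nat \<Rightarrow>\<^sub>0 ('v, 'k::field) mpoly) set"
  where "free_mod X I = {f. supp f \<subseteq> I \<and> (\<forall>k. coef f k \<in> poly_ring X)}"

definition diff_map ::
  "('v, 'x, 'k::field) free_complex \<Rightarrow> nat \<Rightarrow>
    (nat \<Rightarrow>\<^sub>0 ('v, 'k) mpoly) \<Rightarrow> (nat \<Rightarrow>\<^sub>0 ('v, 'k) mpoly)"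
  where "diff_map C i f = (\<Sum>k\<in>supp f. pscale (coef f k) (gdiff C i k))"

definition aug_map ::
  "('v \<Rightarrow> ('x, 'k::field) mpoly) \<Rightarrow> ('v, 'x, 'k) free_complex \<Rightarrow>
    (nat \<Rightarrow>\<^sub>0 ('v, 'k) mpoly) \<Rightarrow> ('x, 'k) mpoly"
  where "aug_map g C f = (\<Sum>k\<in>supp f. poly_subst g (coef f k) * gaug C k)"

text \<open>
  Graded free resolutions of \<open>M = \<Oplus>\<^sub>j G j\<close> over \<open>P\<close>, by free modules having finitely many
  basis elements in each degree, with all maps homogeneous of degree \<open>0\<close>.
\<close>

definition graded_free_resolution ::
  "'v set \<Rightarrow> ('v \<Rightarrow> ('x, 'k::field) mpoly) \<Rightarrow> ('x, 'k) mpoly set \<Rightarrow>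
    (nat \<Rightarrow> ('x, 'k) mpoly set) \<Rightarrow> ('v, 'x, 'k) free_complex \<Rightarrow> bool"
  where "graded_free_resolution X g M G C \<longleftrightarrow>
    (\<forall>i j. finite {k \<in> gbasis C i. gdeg C i k = j}) \<and>
    (\<forall>k\<in>gbasis C 0. gaug C k \<in> G (gdeg C 0 k)) \<and>
    (\<forall>i. \<forall>k\<in>gbasis C (Suc i).
       gdiff C i k \<in> free_mod X (gbasis C i) \<and>
       (\<forall>l. \<forall>s\<in>supp (coef (gdiff C i k) l).
          gdeg C i l + mon_degree s = gdeg C (Suc i) k)) \<and>
    aug_map g C ` free_mod X (gbasis C 0) = M \<and>
    {f \<in> free_mod X (gbasis C 0). aug_map g C f = 0}
      = diff_map C 0 ` free_mod X (gbasis C 1) \<and>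
    (\<forall>i. {f \<in> free_mod X (gbasis C (Suc i)). diff_map C i f = 0}
      = diff_map C (Suc i) ` free_mod X (gbasis C (Suc (Suc i))))"

text \<open>
  \<open>F\<^sub>i \<otimes>\<^sub>P K\<close> is the \<open>K\<close>-vector space on the basis of \<open>F\<^sub>i\<close>. As every \<open>t\<^sub>v\<close> acts as \<open>0\<close> on
  \<open>K\<close>, the matrices of its differentials consist of the constant terms of the entries of
  those of \<open>F\<close>. \<open>tensor_part C i j\<close> is its component of degree \<open>j\<close>.
\<close>

definition tensor_part ::
  "('v, 'x, 'k::field) free_complex \<Rightarrow> nat \<Rightarrow> nat \<Rightarrow> (nat \<Rightarrow>\<^sub>0 'k) set"
  where "tensor_part C i j = {f. supp f \<subseteq> {k \<in> gbasis C i. gdeg C i k = j}}"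

definition tensor_diff ::
  "('v, 'x, 'k::field) free_complex \<Rightarrow> nat \<Rightarrow> (nat \<Rightarrow>\<^sub>0 'k) \<Rightarrow> (nat \<Rightarrow>\<^sub>0 'k)"
  where "tensor_diff C i f =
    (\<Sum>k\<in>supp f. pscale (coef f k) (Poly_Mapping.map (\<lambda>p. coef p 0) (gdiff C i k)))"

definition tor_cycles ::
  "('v, 'x, 'k::field) free_complex \<Rightarrow> nat \<Rightarrow> nat \<Rightarrow> (nat \<Rightarrow>\<^sub>0 'k) set"
  where "tor_cycles C i j = {f \<in> tensor_part C i j.
    case i of 0 \<Rightarrow> True | Suc i' \<Rightarrow> tensor_diff C i' f = 0}"

definition tor_boundaries ::
  "('v, 'x, 'k::field) free_complex \<Rightarrow> nat \<Rightarrow> nat \<Rightarrow> (nat \<Rightarrow>\<^sub>0 'k) set"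
  where "tor_boundaries C i j = tensor_diff C i ` tensor_part C (Suc i) j"

text \<open>
  The dimension of the degree \<open>j\<close> part of \<open>Tor\<^sub>i(M, K) = H\<^sub>i(F \<otimes> K)\<close> for a graded free
  resolution \<open>F\<close> of \<open>M\<close>. Boundaries are cycles and the cycles are finite-dimensional, so the
  subtraction is the dimension of the quotient; as always for Tor, the choice of \<open>F\<close> is
  immaterial.
\<close>

definition tor_dim ::
  "'v set \<Rightarrow> ('v \<Rightarrow> ('x, 'k::field) mpoly) \<Rightarrow> ('x, 'k) mpoly set \<Rightarrow>
    (nat \<Rightarrow> ('x, 'k) mpoly set) \<Rightarrow> nat \<Rightarrow> nat \<Rightarrow> nat"
  where "tor_dim X g M G i j =
    (let C = (SOME C. graded_free_resolution X g M G C)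
     in vector_space.dim pscale (tor_cycles C i j)
        - vector_space.dim pscale (tor_boundaries C i j))"

text \<open>
  The graded Betti number \<open>\<beta>\<^bsub>i,j\<^esub>(A)\<close> of a toric ring \<open>A\<close> generated in degree \<open>d\<close>. The
  variables of \<open>P\<close> are indexed by the minimal monomial generators of \<open>A\<close> themselves.
\<close>

definition betti :: "nat \<Rightarrow> ('x, 'k::field) mpoly set \<Rightarrow> nat \<Rightarrow> nat \<Rightarrow> nat"
  where "betti d A i j = tor_dim (min_gens A) mon_poly A (toric_grading d A) i j"

end

theory Submission
  imports Defs "HOL-Library.Nat_Bijection"
begin

text \<open>
  Let \<open>A\<close> be generated by the set \<open>U\<close> of monomials and \<open>B = A \<inter> K[x\<^sub>i : i \<in> T]\<close>. The monomials in
  the variables from \<open>T\<close> form a face of the monoid of all monomials: a product lies in the face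
  only if every factor does. Therefore \<open>B\<close> is generated by the set \<open>V\<close> of those elements of \<open>U\<close> that
  lie in the face, and killing all other monomials is a ring homomorphism \<open>\<pi> : A \<rightarrow> B\<close> that
  restricts to the identity of \<open>B\<close>. It is compatible with the retraction \<open>K[t\<^sub>u : u \<in> U] \<rightarrow> K[t\<^sub>u : u \<in> V]\<close>
  that kills the variables outside \<open>V\<close> (\<open>restrict_poly_subst\<close>).

  Algebra retracts induce retracts on Tor. Take graded free resolutions \<open>C\<close> of \<open>A\<close> and \<open>C'\<close> of \<open>B\<close>.
  By freeness and exactness the inclusion \<open>B \<rightarrow> A\<close> lifts to a chain map \<open>\<phi> : C' \<rightarrow> C\<close>, and \<open>\<pi>\<close> lifts to
  a chain map \<open>\<psi> : C \<rightarrow> C'\<close> that is semilinear along the retraction of polynomial rings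
  (\<open>chain_map_exists\<close>). The composite \<open>\<psi> \<circ> \<phi>\<close> lifts the identity of \<open>B\<close>, so it differs from the
  identity of \<open>C'\<close> by a homotopy (\<open>null_homotopic\<close>). After tensoring with \<open>K\<close> it is the identity on
  homology, whence \<open>\<phi>\<close> embeds \<open>Tor\<^sub>i(B, K)\<^sub>j\<close> into \<open>Tor\<^sub>i(A, K)\<^sub>j\<close> (\<open>tor_dim_le_of_retract\<close>). This
  works for any two resolutions, in particular for those that define the Betti numbers.

  Those numbers speak about resolutions only because resolutions exist
  (\<open>graded_free_resolution_exists\<close>): in each step one covers a graded module by a free module with
  finitely many generators in each degree, which is possible as all graded components are
  finite-dimensional. Finally, the variables are indexed by minimal generators, so these must be
  known for \<open>B\<close>: a minimal generating set consists of the irreducible elements of the monoid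
  (\<open>minimally_generates_unique\<close>), and generators of equal positive degree are irreducible.
\<close>

section \<open>Linear extension of maps given on a basis\<close>

lemma sum_over_superset:
  fixes f :: "'a \<Rightarrow>\<^sub>0 'c::zero"
  assumes "finite S" "supp f \<subseteq> S" "\<And>k. h k 0 = 0"
  shows "(\<Sum>k\<in>supp f. h k (coef f k)) = (\<Sum>k\<in>S. h k (coef f k))"
  using assms by (intro sum.mono_neutral_left) (auto simp: in_keys_iff)

lemma sum_singles: "(\<Sum>k\<in>supp f. Poly_Mapping.single k (coef f k)) = f"
proof (rule poly_mapping_eqI)
  fix a
  show "coef (\<Sum>k\<in>supp f. Poly_Mapping.single k (coef f k)) a = coef f a"
    by (cases "a \<in> supp f") (auto simp: lookup_sum lookup_single when_def in_keys_iff)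
qed

lemma poly_mapping_single_induct [case_names zero add single]:
  fixes f :: "'a \<Rightarrow>\<^sub>0 'c::comm_monoid_add"
  assumes "P 0" "\<And>f g. P f \<Longrightarrow> P g \<Longrightarrow> P (f + g)"
    "\<And>k. k \<in> supp f \<Longrightarrow> P (Poly_Mapping.single k (coef f k))"
  shows "P f"
proof -
  have "P (\<Sum>k\<in>S. Poly_Mapping.single k (coef f k))" if "finite S" "S \<subseteq> supp f" for S
    using that by (induction S rule: finite_induct) (auto intro: assms)
  from this[of "supp f"] show ?thesis by (simp add: sum_singles)
qed

text \<open>
  Every map in a free complex is given by its values \<open>b k\<close> on a basis. The ways in which scalars
  act on the target differ (scaling, multiplication after a substitution, scaling after a
  ring homomorphism), hence the parameter \<open>act\<close>.
\<close>

definition lin_ext :: "('c::zero \<Rightarrow> 'm \<Rightarrow> 'm) \<Rightarrow> ('a \<Rightarrow> 'm) \<Rightarrow> ('a \<Rightarrow>\<^sub>0 'c) \<Rightarrow> 'm::comm_monoid_add"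
  where "lin_ext act b f = (\<Sum>k\<in>supp f. act (coef f k) (b k))"

lemma lin_ext_over_superset:
  assumes "module act" "finite S" "supp f \<subseteq> S"
  shows "lin_ext act b f = (\<Sum>k\<in>S. act (coef f k) (b k))"
  unfolding lin_ext_def using assms
  by (intro sum_over_superset[where h = "\<lambda>k c. act c (b k)"]) (auto simp: module.scale_zero_left)

lemma lin_ext_add:
  assumes "module act"
  shows "lin_ext act b (f + g) = lin_ext act b f + lin_ext act b g"
proof -
  let ?S = "supp f \<union> supp g"
  have "supp (f + g) \<subseteq> ?S" by (rule Poly_Mapping.keys_add)
  then show ?thesis
    using assms by (simp add: lin_ext_over_superset[where S = ?S] lookup_add
        module.scale_left_distrib sum.distrib)
qed

lemma additive_lin_ext: "module act \<Longrightarrow> additive (lin_ext act b)"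
  by (simp add: additive_def lin_ext_add)

lemma lin_ext_single: "module act \<Longrightarrow> lin_ext act b (Poly_Mapping.single k c) = act c (b k)"
  by (cases "c = 0") (auto simp: lin_ext_def module.scale_zero_left)

lemma lin_ext_cong:
  "(\<And>k. k \<in> supp f \<Longrightarrow> act (coef f k) (b k) = act' (coef f k) (b' k))
    \<Longrightarrow> lin_ext act b f = lin_ext act' b' f"
  by (simp add: lin_ext_def)

lemma lin_ext_diff_basis:
  "module act \<Longrightarrow> lin_ext act (\<lambda>k. b k - c k) f = lin_ext act b f - lin_ext act c f"
  by (simp add: lin_ext_def module.scale_right_diff_distrib sum_subtractf)

lemma additive_lin_ext_image:
  assumes "additive L"
  shows "L (lin_ext act b f) = (\<Sum>k\<in>supp f. L (act (coef f k) (b k)))"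
  by (simp add: lin_ext_def additive.sum[OF assms])

lemma module_pscale: "module (pscale :: 'c::comm_ring_1 \<Rightarrow> ('a \<Rightarrow>\<^sub>0 'c) \<Rightarrow> _)"
  by unfold_locales
    (simp_all add: poly_mapping_eq_iff fun_eq_iff lookup_pscale lookup_add algebra_simps)

lemma pscale_single: "pscale c (Poly_Mapping.single k d) = Poly_Mapping.single k (c * d)"
  by (rule poly_mapping_eqI) (simp add: lookup_pscale lookup_single when_def)

lemma supp_pscale: "supp (pscale c f) \<subseteq> supp f"
  by (auto simp: in_keys_iff lookup_pscale)

lemma lin_ext_pscale:
  fixes f :: "'a \<Rightarrow>\<^sub>0 'c::comm_ring_1"
  assumes "module act"
  shows "lin_ext act b (pscale c f) = act c (lin_ext act b f)"
proof -
  have "lin_ext act b (pscale c f) = (\<Sum>k\<in>supp f. act (c * coef f k) (b k))"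
    using assms by (simp add: lin_ext_over_superset[OF _ _ supp_pscale] lookup_pscale)
  also have "\<dots> = act c (lin_ext act b f)"
    using assms by (simp add: lin_ext_def module.scale_sum_right module.scale_scale)
  finally show ?thesis .
qed

section \<open>Monoid algebras, monomials and restriction to faces\<close>

lemma pscale_eq_mult: "pscale c f = const_poly c * f"
  by (simp add: pscale_def const_poly_def mult_map_scale_conv_mult)

lemma single_eq_pscale_mon_poly:
  "Poly_Mapping.single s c = pscale (c::'k::field) (mon_poly s)"
  by (simp add: mon_poly_def pscale_single)

lemma mon_poly_add: "mon_poly (s + t) = mon_poly s * (mon_poly t :: ('x,'k::field) mpoly)"
  by (simp add: mon_poly_def mult_single)

text \<open>The universal property of the monoid algebra, for multiplicative maps \<open>b\<close>.\<close>

lemma lin_ext_mult: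
  fixes b :: "'v monomial \<Rightarrow> ('x, 'k::field) mpoly"
  assumes "\<And>s t. b (s + t) = b s * b t"
  shows "lin_ext pscale b (p * q) = lin_ext pscale b p * lin_ext pscale b q"
proof -
  note m = module_pscale
  note [simp] = lin_ext_add[OF m] lin_ext_single[OF m] additive.zero[OF additive_lin_ext[OF m]]
  have single: "pscale (c * e) (b s * b t) = pscale c (b s) * pscale e (b t)" for c e s t
    by (simp add: pscale_eq_mult const_poly_def mult_single[of 0 c 0 e, simplified, symmetric]
        ac_simps)
  have "lin_ext pscale b (Poly_Mapping.single s c * q) = pscale c (b s) * lin_ext pscale b q" for s c
    by (induction q rule: poly_mapping_single_induct)
      (simp_all add: distrib_left mult_single assms single)
  then show ?thesis
    by (induction p rule: poly_mapping_single_induct) (simp_all add: distrib_right)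
qed

lemma mon_degree_eq_sum:
  "finite S \<Longrightarrow> supp w \<subseteq> S \<Longrightarrow> mon_degree w = (\<Sum>x\<in>S. coef w x)"
  unfolding mon_degree_def by (rule sum_over_superset[where h = "\<lambda>_ c. c"]) auto

lemma supp_add_monomial: "supp (s + t :: 'x monomial) = supp s \<union> supp t"
  by (auto simp: in_keys_iff lookup_add)

lemma mon_degree_add [simp]: "mon_degree (s + t) = mon_degree s + mon_degree t"
  by (simp add: mon_degree_eq_sum[where S = "supp s \<union> supp t"] supp_add_monomial lookup_add
      sum.distrib)

lemma mon_degree_zero [simp]: "mon_degree 0 = 0"
  by (simp add: mon_degree_def)

lemma mon_degree_eq_0_iff [simp]: "mon_degree s = 0 \<longleftrightarrow> s = 0"
  by (auto simp: mon_degree_def in_keys_iff intro: poly_mapping_eqI)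

lemma coef_le_mon_degree: "coef s x \<le> mon_degree s"
proof (cases "x \<in> supp s")
  case True
  then show ?thesis unfolding mon_degree_def by (intro member_le_sum) auto
qed (simp add: in_keys_iff)

lemma finite_monomials_of_degree:
  assumes "finite X"
  shows "finite {s :: 'x monomial. supp s \<subseteq> X \<and> mon_degree s = m}" (is "finite ?S")
proof (rule inj_on_finite[where f = "\<lambda>s x. if x \<in> X then coef s x else 0"])
  show "inj_on (\<lambda>s x. if x \<in> X then coef s x else 0) ?S"
  proof (rule inj_onI, rule poly_mapping_eqI)
    fix s t x
    assume st: "s \<in> ?S" "t \<in> ?S"
      and eq: "(\<lambda>x. if x \<in> X then coef s x else 0) = (\<lambda>x. if x \<in> X then coef t x else 0)"
    have outside: "coef w x = 0" if "w \<in> ?S" "x \<notin> X" for w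
      using that by (auto simp flip: not_in_keys_iff_lookup_eq_zero)
    show "coef s x = coef t x"
      using fun_cong[OF eq, of x] outside st by (cases "x \<in> X") simp_all
  qed
  show "(\<lambda>s x. if x \<in> X then coef s x else 0) ` ?S
      \<subseteq> {h. \<forall>x. (x \<in> X \<longrightarrow> h x \<in> {..m}) \<and> (x \<notin> X \<longrightarrow> h x = 0)}"
    using coef_le_mon_degree by (auto simp: coef_le_mon_degree)
  show "finite {h. \<forall>x. (x \<in> X \<longrightarrow> h x \<in> {..m}) \<and> (x \<notin> X \<longrightarrow> h x = (0::nat))}"
    using assms by (intro finite_set_of_finite_funs) auto
qed

definition restrict :: "'a set \<Rightarrow> ('a \<Rightarrow>\<^sub>0 'c::zero) \<Rightarrow> ('a \<Rightarrow>\<^sub>0 'c)"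
  where "restrict F f = Poly_Mapping.mapp (\<lambda>a c. c when a \<in> F) f"

lemma lookup_restrict: "coef (restrict F f) a = (coef f a when a \<in> F)"
  by (auto simp: restrict_def lookup_mapp when_def in_keys_iff)

lemma supp_restrict: "supp (restrict F f) = supp f \<inter> F"
  by (auto simp: in_keys_iff lookup_restrict)

lemma additive_restrict: "additive (restrict F :: _ \<Rightarrow> ('a \<Rightarrow>\<^sub>0 'c::ab_group_add))"
  by (auto simp: additive_def poly_mapping_eq_iff fun_eq_iff lookup_restrict lookup_add when_def)

lemma restrict_single:
  "restrict F (Poly_Mapping.single a c) = (Poly_Mapping.single a c when a \<in> F)"
  by (rule poly_mapping_eqI) (auto simp: lookup_restrict lookup_single when_def)

lemma restrict_id: "supp f \<subseteq> F \<Longrightarrow> restrict F f = f"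
  by (rule poly_mapping_eqI) (auto simp: lookup_restrict when_def in_keys_iff)

lemma restrict_eq_0: "supp f \<inter> F = {} \<Longrightarrow> restrict F f = 0"
  by (rule poly_mapping_eqI) (auto simp: lookup_restrict when_def in_keys_iff)

lemma restrict_pscale: "restrict F (pscale c f) = pscale c (restrict F f)"
  by (rule poly_mapping_eqI) (auto simp: lookup_restrict lookup_pscale when_def)

definition face :: "'a::comm_monoid_add set \<Rightarrow> bool"
  where "face F \<longleftrightarrow> 0 \<in> F \<and> (\<forall>s t. s + t \<in> F \<longleftrightarrow> s \<in> F \<and> t \<in> F)"

lemma face_monomials: "face {s :: 'x monomial. supp s \<subseteq> X}"
  by (auto simp: face_def supp_add_monomial)

text \<open>
  The monomials outside a face span an ideal, and killing that ideal is the retraction behind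
  combinatorial pure subrings.
\<close>

lemma restrict_mult:
  fixes p q :: "'a::comm_monoid_add \<Rightarrow>\<^sub>0 'c::comm_ring_1"
  assumes "face F"
  shows "restrict F (p * q) = restrict F p * restrict F q"
proof -
  note [simp] = additive.zero[OF additive_restrict] additive.add[OF additive_restrict]
    restrict_single mult_single
  have "restrict F (Poly_Mapping.single s c * q) = (Poly_Mapping.single s c when s \<in> F) * restrict F q"
    for s c
    using assms by (induction q rule: poly_mapping_single_induct)
      (auto simp: distrib_left when_def face_def)
  then show ?thesis
    by (induction p rule: poly_mapping_single_induct) (simp_all add: distrib_right)
qed

lemma restrict_one: "face F \<Longrightarrow> restrict F (1 :: 'a::comm_monoid_add \<Rightarrow>\<^sub>0 'c::comm_ring_1) = 1"
  by (simp add: restrict_id face_def)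

lemma module_pscale_restrict:
  assumes "face F"
  shows "module (\<lambda>p. pscale (restrict F p :: 'a::comm_monoid_add \<Rightarrow>\<^sub>0 'c::comm_ring_1)
    :: ('b \<Rightarrow>\<^sub>0 _) \<Rightarrow> _)"
  using assms by (intro module.intro)
    (simp_all add: additive.add[OF additive_restrict] restrict_mult restrict_one
      module.scale_left_distrib[OF module_pscale] module.scale_right_distrib[OF module_pscale]
      module.scale_one[OF module_pscale] module.scale_scale[OF module_pscale])

section \<open>The substitution homomorphism\<close>

lemma poly_subst_eq_lin_ext:
  "poly_subst g = lin_ext pscale (\<lambda>s. \<Prod>v\<in>supp s. g v ^ coef s v)"
  by (rule ext) (simp add: poly_subst_def lin_ext_def pscale_eq_mult)

lemma prod_powers_add:
  fixes g :: "'v \<Rightarrow> 'r::comm_semiring_1" and s t :: "'v monomial"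
  shows "(\<Prod>v\<in>supp (s + t). g v ^ coef (s + t) v)
    = (\<Prod>v\<in>supp s. g v ^ coef s v) * (\<Prod>v\<in>supp t. g v ^ coef t v)"
proof -
  let ?S = "supp s \<union> supp t"
  have *: "(\<Prod>v\<in>supp w. g v ^ coef w v) = (\<Prod>v\<in>?S. g v ^ coef w v)" if "supp w \<subseteq> ?S" for w
    using that by (intro prod.mono_neutral_left) (auto simp: in_keys_iff)
  show ?thesis
    by (simp add: *[of s] *[of t] *[of "s + t"] supp_add_monomial lookup_add power_add prod.distrib)
qed

lemma poly_subst_mult: "poly_subst g (p * q) = poly_subst g p * poly_subst g q"
  unfolding poly_subst_eq_lin_ext by (rule lin_ext_mult) (rule prod_powers_add)

lemma additive_poly_subst: "additive (poly_subst g)"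
  unfolding poly_subst_eq_lin_ext by (rule additive_lin_ext[OF module_pscale])

lemma poly_subst_one: "poly_subst g 1 = 1"
  by (simp add: poly_subst_def const_poly_def)

lemma module_poly_subst: "module (\<lambda>p m. poly_subst g p * m)"
  by (intro module.intro)
    (simp_all add: poly_subst_mult poly_subst_one additive.add[OF additive_poly_subst] algebra_simps)

text \<open>The image of the monomial \<open>t\<^sup>s\<close> under \<open>t\<^sub>u \<mapsto> u\<close>; monoids are written additively.\<close>

definition expand :: "'x monomial monomial \<Rightarrow> 'x monomial"
  where "expand s = (\<Sum>u\<in>supp s. pscale (coef s u) u)"

lemma mon_poly_zero: "mon_poly 0 = (1 :: ('x, 'k::field) mpoly)"
  by (simp add: mon_poly_def)

lemma mon_poly_power: "mon_poly u ^ m = (mon_poly (pscale m u) :: ('x, 'k::field) mpoly)"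
proof (induction m)
  case 0
  have "pscale 0 u = 0" by (rule poly_mapping_eqI) (simp add: lookup_pscale)
  then show ?case by (simp add: mon_poly_zero)
next
  case (Suc m)
  have "pscale (Suc m) u = u + pscale m u"
    by (rule poly_mapping_eqI) (simp add: lookup_pscale lookup_add)
  then show ?case using Suc by (simp add: mon_poly_add)
qed

lemma prod_mon_poly:
  "(\<Prod>v\<in>S. mon_poly (h v)) = (mon_poly (\<Sum>v\<in>S. h v) :: ('x, 'k::field) mpoly)"
  by (induction S rule: infinite_finite_induct) (simp_all add: mon_poly_add mon_poly_zero)

lemma poly_subst_single:
  "poly_subst mon_poly (Poly_Mapping.single s c) = Poly_Mapping.single (expand s) (c :: 'k::field)"
  by (simp add: poly_subst_eq_lin_ext lin_ext_single[OF module_pscale] mon_poly_power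
      prod_mon_poly expand_def single_eq_pscale_mon_poly[of "expand s" for s, unfolded expand_def])

lemma mon_degree_sum: "mon_degree (\<Sum>v\<in>S. h v) = (\<Sum>v\<in>S. mon_degree (h v))"
  by (induction S rule: infinite_finite_induct) simp_all

lemma mon_degree_pscale: "mon_degree (pscale m u) = m * mon_degree u"
  by (simp add: mon_degree_eq_sum[where S = "supp u"] supp_pscale lookup_pscale sum_distrib_left)

lemma mon_degree_expand:
  assumes "\<forall>u\<in>supp s. mon_degree u = d"
  shows "mon_degree (expand s) = d * mon_degree s"
proof -
  have "mon_degree (expand s) = (\<Sum>u\<in>supp s. coef s u * d)"
    using assms by (simp add: expand_def mon_degree_sum mon_degree_pscale)
  also have "\<dots> = d * mon_degree s"
    by (simp add: mon_degree_def sum_distrib_left mult.commute)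
  finally show ?thesis .
qed

lemma supp_sum_monomial: "finite S \<Longrightarrow> supp (\<Sum>v\<in>S. h v :: 'x monomial) = (\<Union>v\<in>S. supp (h v))"
  by (induction S rule: finite_induct) (simp_all add: supp_add_monomial)

lemma supp_expand: "supp (expand s) = (\<Union>u\<in>supp s. supp u)"
  by (auto simp: expand_def supp_sum_monomial in_keys_iff lookup_pscale)

section \<open>Graded free modules\<close>

lemma poly_ring_0 [simp]: "0 \<in> poly_ring X"
  by (simp add: poly_ring_def)

lemma poly_ring_single: "supp s \<subseteq> X \<Longrightarrow> Poly_Mapping.single s c \<in> poly_ring X"
  by (simp add: poly_ring_def)

lemma poly_ring_const [simp]: "const_poly c \<in> poly_ring X"
  by (simp add: const_poly_def poly_ring_single)

lemma poly_ring_add: "p \<in> poly_ring X \<Longrightarrow> q \<in> poly_ring X \<Longrightarrow> p + q \<in> poly_ring X"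
  using Poly_Mapping.keys_add[of p q] by (auto simp: poly_ring_def)

lemma poly_ring_mult:
  "p \<in> poly_ring X \<Longrightarrow> q \<in> poly_ring X \<Longrightarrow> p * q \<in> poly_ring X"
  using keys_mult[of p q] by (fastforce simp: poly_ring_def supp_add_monomial)

lemma poly_ring_restrict: "p \<in> poly_ring X \<Longrightarrow> restrict F p \<in> poly_ring X"
  by (auto simp: poly_ring_def supp_restrict)

lemma free_mod_0 [simp]: "0 \<in> free_mod X I"
  by (simp add: free_mod_def)

lemma free_mod_add: "f \<in> free_mod X I \<Longrightarrow> g \<in> free_mod X I \<Longrightarrow> f + g \<in> free_mod X I"
  using Poly_Mapping.keys_add[of f g] by (auto simp: free_mod_def lookup_add poly_ring_add)

lemma free_mod_pscale: "p \<in> poly_ring X \<Longrightarrow> f \<in> free_mod X I \<Longrightarrow> pscale p f \<in> free_mod X I"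
  using supp_pscale[of p f] by (auto simp: free_mod_def lookup_pscale poly_ring_mult)

lemma free_mod_sum: "(\<And>k. k \<in> S \<Longrightarrow> h k \<in> free_mod X I) \<Longrightarrow> (\<Sum>k\<in>S. h k) \<in> free_mod X I"
  by (induction S rule: infinite_finite_induct) (auto intro: free_mod_add)

lemma free_mod_single:
  "k \<in> I \<Longrightarrow> p \<in> poly_ring X \<Longrightarrow> Poly_Mapping.single k p \<in> free_mod X I"
  by (auto simp: free_mod_def lookup_single when_def)

lemma free_mod_uminus: "f \<in> free_mod X I \<Longrightarrow> - f \<in> free_mod X I"
  by (auto simp: free_mod_def poly_ring_def)

lemma free_mod_diff: "f \<in> free_mod X I \<Longrightarrow> g \<in> free_mod X I \<Longrightarrow> f - g \<in> free_mod X I"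
  using free_mod_add[of f X I "- g"] free_mod_uminus[of g X I] by simp

definition hom_part ::
  "'v set \<Rightarrow> nat set \<Rightarrow> (nat \<Rightarrow> nat) \<Rightarrow> nat \<Rightarrow> (nat \<Rightarrow>\<^sub>0 ('v, 'k::field) mpoly) set"
  where "hom_part X I deg j =
    {f \<in> free_mod X I. \<forall>k. \<forall>s\<in>supp (coef f k). deg k + mon_degree s = j}"

lemma hom_part_free_mod: "f \<in> hom_part X I deg j \<Longrightarrow> f \<in> free_mod X I"
  by (simp add: hom_part_def)

lemma hom_part_0 [simp]: "0 \<in> hom_part X I deg j"
  by (simp add: hom_part_def)

lemma hom_part_add:
  "f \<in> hom_part X I deg j \<Longrightarrow> g \<in> hom_part X I deg j \<Longrightarrow> f + g \<in> hom_part X I deg j"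
  using Poly_Mapping.keys_add[of "coef f k" "coef g k" for k]
  by (fastforce simp: hom_part_def free_mod_add lookup_add)

lemma hom_part_sum:
  "(\<And>k. k \<in> S \<Longrightarrow> h k \<in> hom_part X I deg j) \<Longrightarrow> (\<Sum>k\<in>S. h k) \<in> hom_part X I deg j"
  by (induction S rule: infinite_finite_induct) (auto intro: hom_part_add)

lemma hom_part_pscale:
  assumes "p \<in> poly_ring X" "\<forall>s\<in>supp p. mon_degree s = a" "f \<in> hom_part X I deg j" "a + j = l"
  shows "pscale p f \<in> hom_part X I deg l"
  unfolding hom_part_def
proof (safe)
  show "pscale p f \<in> free_mod X I"
    using assms free_mod_pscale hom_part_free_mod by blast
  fix k s
  assume "s \<in> supp (coef (pscale p f) k)"
  then have "s \<in> supp (p * coef f k)" by (simp add: lookup_pscale)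
  then obtain t u where "t \<in> supp p" "u \<in> supp (coef f k)" "s = t + u"
    using keys_mult[of p "coef f k"] by blast
  then show "deg k + mon_degree s = l"
    using assms by (auto simp: hom_part_def)
qed

definition hcomp ::
  "(nat \<Rightarrow> nat) \<Rightarrow> nat \<Rightarrow> (nat \<Rightarrow>\<^sub>0 ('v, 'k::field) mpoly) \<Rightarrow> (nat \<Rightarrow>\<^sub>0 ('v, 'k) mpoly)"
  where "hcomp deg j f =
    Poly_Mapping.mapp (\<lambda>k. restrict {s. deg k + mon_degree s = j}) f"

lemma lookup_hcomp: "coef (hcomp deg j f) k = restrict {s. deg k + mon_degree s = j} (coef f k)"
  by (auto simp: hcomp_def lookup_mapp when_def in_keys_iff restrict_eq_0)

lemma additive_hcomp: "additive (hcomp deg j)"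
  by (auto simp: additive_def poly_mapping_eq_iff[of _ "_ + _"] fun_eq_iff lookup_hcomp lookup_add
      additive.add[OF additive_restrict])

lemma hcomp_hom_part: "f \<in> free_mod X I \<Longrightarrow> hcomp deg j f \<in> hom_part X I deg j"
proof -
  assume f: "f \<in> free_mod X I"
  have "supp (hcomp deg j f) \<subseteq> supp f"
    unfolding hcomp_def by (rule keys_mapp_subset)
  then show ?thesis
    using f by (auto simp: hom_part_def free_mod_def lookup_hcomp supp_restrict poly_ring_restrict)
qed

lemma hcomp_id: "f \<in> hom_part X I deg j \<Longrightarrow> hcomp deg j f = f"
  by (rule poly_mapping_eqI) (auto simp: lookup_hcomp hom_part_def intro: restrict_id)

lemma hcomp_other: "f \<in> hom_part X I deg i \<Longrightarrow> i \<noteq> j \<Longrightarrow> hcomp deg j f = 0"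
  by (rule poly_mapping_eqI) (auto simp: lookup_hcomp hom_part_def intro!: restrict_eq_0)

lemma sum_hcomp:
  assumes "finite J" "\<forall>k s. s \<in> supp (coef f k) \<longrightarrow> deg k + mon_degree s \<in> J"
  shows "(\<Sum>j\<in>J. hcomp deg j f) = f"
proof (rule poly_mapping_eqI, rule poly_mapping_eqI)
  fix k s
  show "coef (coef (\<Sum>j\<in>J. hcomp deg j f) k) s = coef (coef f k) s"
    using assms by (cases "s \<in> supp (coef f k)")
      (auto simp: lookup_sum lookup_hcomp lookup_restrict when_def in_keys_iff)
qed

lemma ex_sum_hcomp:
  fixes f :: "nat \<Rightarrow>\<^sub>0 ('v, 'k::field) mpoly"
  shows "\<exists>J. finite J \<and> i \<in> J \<and> (\<Sum>j\<in>J. hcomp deg j f) = f"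
proof -
  let ?J = "insert i (\<Union>k\<in>supp f. (\<lambda>s. deg k + mon_degree s) ` supp (coef f k))"
  have "\<forall>k s. s \<in> supp (coef f k) \<longrightarrow> deg k + mon_degree s \<in> ?J"
  proof (intro allI impI)
    fix k s
    assume s: "s \<in> supp (coef f k)"
    then have "k \<in> supp f" by (auto simp: in_keys_iff)
    with s show "deg k + mon_degree s \<in> ?J" by blast
  qed
  then have "(\<Sum>j\<in>?J. hcomp deg j f) = f" by (intro sum_hcomp) auto
  then show ?thesis by (intro exI[of _ ?J]) auto
qed

text \<open>
  A map that respects degrees commutes with taking components; the target is described only by
  its projection \<open>Q\<close> onto the component of degree \<open>j\<close>, so that the target may be a free module or
  a ring of polynomials.
\<close>

lemma hcomp_commute:
  assumes "additive L" "additive Q" "f \<in> free_mod X I"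
    and graded: "\<And>i g. g \<in> hom_part X I deg i \<Longrightarrow> Q (L g) = (L g when i = j)"
  shows "L (hcomp deg j f) = Q (L f)"
proof -
  obtain J where J: "finite J" "j \<in> J" "(\<Sum>i\<in>J. hcomp deg i f) = f"
    using ex_sum_hcomp by metis
  have "Q (L f) = (\<Sum>i\<in>J. Q (L (hcomp deg i f)))"
    by (subst J(3)[symmetric]) (simp only: additive.sum[OF assms(1)] additive.sum[OF assms(2)])
  also have "\<dots> = (\<Sum>i\<in>J. L (hcomp deg i f) when i = j)"
    using graded hcomp_hom_part[OF assms(3)] by (intro sum.cong) auto
  also have "\<dots> = L (hcomp deg j f)"
    using J by (simp add: when_def)
  finally show ?thesis ..
qed

text \<open>
  The maps between free modules: semilinear along the retraction \<open>restrict F\<close> of polynomials.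
  The case \<open>F = UNIV\<close> is that of linear maps, so that it covers the differentials.
\<close>

definition semilin ::
  "'v monomial set \<Rightarrow> (nat \<Rightarrow> nat \<Rightarrow>\<^sub>0 ('v, 'k::field) mpoly) \<Rightarrow>
    (nat \<Rightarrow>\<^sub>0 ('v, 'k) mpoly) \<Rightarrow> (nat \<Rightarrow>\<^sub>0 ('v, 'k) mpoly)"
  where "semilin F b = lin_ext (\<lambda>p. pscale (restrict F p)) b"

lemma additive_semilin: "face F \<Longrightarrow> additive (semilin F b)"
  unfolding semilin_def by (rule additive_lin_ext[OF module_pscale_restrict])

lemma semilin_single: "face F \<Longrightarrow> semilin F b (Poly_Mapping.single k p) = pscale (restrict F p) (b k)"
  unfolding semilin_def by (rule lin_ext_single[OF module_pscale_restrict])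

lemma semilin_pscale:
  "face F \<Longrightarrow> semilin F b (pscale p f) = pscale (restrict F p) (semilin F b f)"
  unfolding semilin_def by (rule lin_ext_pscale[OF module_pscale_restrict])

lemma semilin_cong:
  "(\<And>k. k \<in> supp f \<Longrightarrow> b k = c k) \<Longrightarrow> semilin F b f = semilin F c f"
  unfolding semilin_def by (rule lin_ext_cong) simp

lemma semilin_diff_basis:
  "face F \<Longrightarrow> semilin F (\<lambda>k. b k - c k) f = semilin F b f - semilin F c f"
  unfolding semilin_def by (rule lin_ext_diff_basis[OF module_pscale_restrict])

lemma restrict_UNIV [simp]: "restrict UNIV p = p"
  by (simp add: restrict_id)

lemma face_UNIV [simp]: "face UNIV"
  by (simp add: face_def)

lemma restrict_restrict: "restrict F (restrict G p) = restrict (F \<inter> G) p"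
  by (rule poly_mapping_eqI) (auto simp: lookup_restrict when_def)

lemma diff_map_eq_semilin: "diff_map C i = semilin UNIV (gdiff C i)"
  by (rule ext) (simp add: diff_map_def semilin_def lin_ext_def)

lemma semilin_semilin:
  assumes "face F" "face G"
  shows "semilin F c (semilin G b f) = semilin (F \<inter> G) (\<lambda>k. semilin F c (b k)) f"
proof -
  have "semilin F c (lin_ext (\<lambda>p. pscale (restrict G p)) b f)
      = (\<Sum>k\<in>supp f. pscale (restrict (F \<inter> G) (coef f k)) (semilin F c (b k)))"
    by (simp add: additive_lin_ext_image[OF additive_semilin[OF assms(1)]]
        semilin_pscale[OF assms(1)] restrict_restrict)
  then show ?thesis by (simp add: semilin_def lin_ext_def)
qed

lemma semilin_fixed:
  assumes "\<And>k. coef f k \<in> poly_ring X" "{s. supp s \<subseteq> X} \<subseteq> F"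
  shows "semilin F b f = semilin UNIV b f"
proof -
  have "restrict F (coef f k) = coef f k" for k
    using assms(1)[of k] assms(2) by (intro restrict_id) (auto simp: poly_ring_def)
  then show ?thesis unfolding semilin_def by (intro lin_ext_cong) simp
qed

lemma semilin_basis: "semilin UNIV (\<lambda>k. Poly_Mapping.single k 1) f = f"
  by (simp add: semilin_def lin_ext_def pscale_single sum_singles)

lemma semilin_closed:
  fixes f :: "nat \<Rightarrow>\<^sub>0 ('v, 'k::field) mpoly"
  assumes "\<And>k. coef f k \<in> poly_ring X" "\<And>k. k \<in> supp f \<Longrightarrow> b k \<in> free_mod Y I'"
    "\<And>p :: ('v, 'k) mpoly. p \<in> poly_ring X \<Longrightarrow> restrict F p \<in> poly_ring Y"
  shows "semilin F b f \<in> free_mod Y I'"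
  unfolding semilin_def lin_ext_def using assms by (intro free_mod_sum free_mod_pscale) auto

lemma semilin_hom_part:
  fixes f :: "nat \<Rightarrow>\<^sub>0 ('v, 'k::field) mpoly"
  assumes "f \<in> hom_part X I deg j" "\<And>k. k \<in> I \<Longrightarrow> b k \<in> hom_part Y I' deg' (deg k)"
    "\<And>p :: ('v, 'k) mpoly. p \<in> poly_ring X \<Longrightarrow> restrict F p \<in> poly_ring Y"
  shows "semilin F b f \<in> hom_part Y I' deg' j"
  unfolding semilin_def lin_ext_def
proof (intro hom_part_sum)
  fix k
  assume k: "k \<in> supp f"
  with assms(1) have kI: "k \<in> I" and p: "coef f k \<in> poly_ring X"
    by (auto simp: hom_part_def free_mod_def)
  have deg: "deg k + mon_degree s = j" if "s \<in> supp (coef f k)" for s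
    using assms(1) that by (auto simp: hom_part_def)
  from k obtain s where s: "s \<in> supp (coef f k)"
    by (force simp: in_keys_iff poly_mapping_eq_iff fun_eq_iff)
  show "pscale (restrict F (coef f k)) (b k) \<in> hom_part Y I' deg' j"
  proof (rule hom_part_pscale[OF assms(3)[OF p] _ assms(2)[OF kI]])
    show "\<forall>t\<in>supp (restrict F (coef f k)). mon_degree t = j - deg k"
      using deg by (force simp: supp_restrict)
    show "j - deg k + deg k = j" using deg[OF s] by simp
  qed
qed

section \<open>Comparison of graded free resolutions\<close>

text \<open>
  Treating the kernel of the augmentation as the cycles in degree \<open>0\<close> makes exactness one
  statement for all positions of the resolution.
\<close>

definition cycles ::
  "'v set \<Rightarrow> ('v \<Rightarrow> ('x, 'k::field) mpoly) \<Rightarrow> ('v, 'x, 'k) free_complex \<Rightarrow> nat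
    \<Rightarrow> (nat \<Rightarrow>\<^sub>0 ('v, 'k) mpoly) set"
  where "cycles X g C n = {f \<in> free_mod X (gbasis C n).
    case n of 0 \<Rightarrow> aug_map g C f = 0 | Suc i \<Rightarrow> diff_map C i f = 0}"

lemma exactness:
  "graded_free_resolution X g M G C \<Longrightarrow>
    cycles X g C n = diff_map C n ` free_mod X (gbasis C (Suc n))"
  by (cases n) (simp_all add: graded_free_resolution_def cycles_def)

lemma gaug_in:
  "graded_free_resolution X g M G C \<Longrightarrow> k \<in> gbasis C 0 \<Longrightarrow> gaug C k \<in> G (gdeg C 0 k)"
  by (simp add: graded_free_resolution_def)

lemma aug_map_image:
  "graded_free_resolution X g M G C \<Longrightarrow> aug_map g C ` free_mod X (gbasis C 0) = M"
  by (simp add: graded_free_resolution_def)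

lemma gdiff_hom_part:
  "graded_free_resolution X g M G C \<Longrightarrow> k \<in> gbasis C (Suc i) \<Longrightarrow>
    gdiff C i k \<in> hom_part X (gbasis C i) (gdeg C i) (gdeg C (Suc i) k)"
  by (simp add: graded_free_resolution_def hom_part_def)

lemma gdiff_cycle:
  assumes "graded_free_resolution X g M G C" "k \<in> gbasis C (Suc i)"
  shows "gdiff C i k \<in> cycles X g C i"
proof -
  have "gdiff C i k = diff_map C i (Poly_Mapping.single k 1)"
    by (simp add: diff_map_eq_semilin semilin_single module.scale_one[OF module_pscale])
  moreover have "Poly_Mapping.single k 1 \<in> free_mod X (gbasis C (Suc i))"
    using assms(2) by (intro free_mod_single) (auto simp flip: single_one intro: poly_ring_single)
  ultimately show ?thesis using exactness[OF assms(1)] by blast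
qed

lemma diff_map_hom_part:
  assumes "graded_free_resolution X g M G C"
    "f \<in> hom_part X (gbasis C (Suc i)) (gdeg C (Suc i)) j"
  shows "diff_map C i f \<in> hom_part X (gbasis C i) (gdeg C i) j"
  unfolding diff_map_eq_semilin
  using gdiff_hom_part[OF assms(1)] by (intro semilin_hom_part[OF assms(2)]) auto

text \<open>
  The differential preserves degrees, so the component of degree \<open>j\<close> of any preimage is again a
  preimage.
\<close>

lemma homogeneous_preimage:
  fixes C :: "('v, 'x, 'k::field) free_complex"
  assumes C: "graded_free_resolution X g M G C"
    and z: "z \<in> hom_part X (gbasis C i) (gdeg C i) j" "z \<in> cycles X g C i"
  shows "\<exists>y\<in>hom_part X (gbasis C (Suc i)) (gdeg C (Suc i)) j. diff_map C i y = z"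
proof -
  obtain y where y: "y \<in> free_mod X (gbasis C (Suc i))" "diff_map C i y = z"
    using z(2) exactness[OF C] by auto
  have "diff_map C i (hcomp (gdeg C (Suc i)) j y) = hcomp (gdeg C i) j (diff_map C i y)"
  proof (rule hcomp_commute[OF _ additive_hcomp y(1)])
    show "additive (diff_map C i)"
      unfolding diff_map_eq_semilin by (simp add: additive_semilin)
    fix l and f :: "nat \<Rightarrow>\<^sub>0 ('v, 'k) mpoly"
    assume "f \<in> hom_part X (gbasis C (Suc i)) (gdeg C (Suc i)) l"
    then have "diff_map C i f \<in> hom_part X (gbasis C i) (gdeg C i) l"
      by (rule diff_map_hom_part[OF C])
    then show "hcomp (gdeg C i) j (diff_map C i f) = (diff_map C i f when l = j)"
      using hcomp_id hcomp_other by (cases "l = j") auto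
  qed
  then show ?thesis using y z hcomp_id hcomp_hom_part by metis
qed

lemma aug_map_eq_lin_ext: "aug_map g C = lin_ext (\<lambda>p m. poly_subst g p * m) (gaug C)"
  by (rule ext) (simp add: aug_map_def lin_ext_def)

lemma additive_aug_map: "additive (aug_map g C)"
  unfolding aug_map_eq_lin_ext by (rule additive_lin_ext[OF module_poly_subst])

lemma aug_map_semilin:
  "aug_map g C (semilin F b f) = (\<Sum>k\<in>supp f. poly_subst g (restrict F (coef f k)) * aug_map g C (b k))"
  by (simp add: semilin_def additive_lin_ext_image[OF additive_aug_map])
    (simp add: aug_map_eq_lin_ext lin_ext_pscale[OF module_poly_subst])

text \<open>
  A graded module over \<open>poly_ring X\<close> with finite-dimensional components; \<open>proj j\<close> is the
  projection onto the component of degree \<open>j\<close>. Both the ring that is resolved and the kernels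
  that occur in its resolution are of this form, with different actions.
\<close>

locale graded_act =
  fixes X :: "'v set" and act :: "('v, 'k::field) mpoly \<Rightarrow> 'm::ab_group_add \<Rightarrow> 'm"
    and M :: "'m set" and G :: "nat \<Rightarrow> 'm set" and proj :: "nat \<Rightarrow> 'm \<Rightarrow> 'm"
  assumes module_act: "module act"
    and G_0: "0 \<in> G j"
    and G_add: "m \<in> G j \<Longrightarrow> m' \<in> G j \<Longrightarrow> m + m' \<in> G j"
    and finite_dim_G: "\<exists>S. finite S \<and> S \<subseteq> G j \<and>
      (\<forall>m\<in>G j. \<exists>c. m = (\<Sum>b\<in>S. act (const_poly (c b)) b))"
    and G_subset: "G j \<subseteq> M"
    and M_add: "m \<in> M \<Longrightarrow> m' \<in> M \<Longrightarrow> m + m' \<in> M"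
    and M_act: "p \<in> poly_ring X \<Longrightarrow> m \<in> M \<Longrightarrow> act p m \<in> M"
    and G_act: "p \<in> poly_ring X \<Longrightarrow> \<forall>s\<in>supp p. mon_degree s = a \<Longrightarrow> m \<in> G j
      \<Longrightarrow> act p m \<in> G (a + j)"
    and additive_proj: "additive (proj j)"
    and proj_G: "m \<in> G i \<Longrightarrow> proj j m = (m when i = j)"
    and proj_in: "m \<in> M \<Longrightarrow> proj j m \<in> G j"
    and sum_proj: "m \<in> M \<Longrightarrow> \<exists>J. finite J \<and> (\<Sum>j\<in>J. proj j m) = m"
begin

lemma G_sum: "(\<And>k. k \<in> S \<Longrightarrow> h k \<in> G j) \<Longrightarrow> (\<Sum>k\<in>S. h k) \<in> G j"
  by (induction S rule: infinite_finite_induct) (auto intro: G_0 G_add)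

lemma M_sum: "(\<And>k. k \<in> S \<Longrightarrow> h k \<in> M) \<Longrightarrow> (\<Sum>k\<in>S. h k) \<in> M"
  using G_0 G_subset by (induction S rule: infinite_finite_induct) (auto intro: M_add)

lemma lin_ext_G:
  assumes b: "\<And>k. k \<in> I \<Longrightarrow> b k \<in> G (deg k)" and f: "f \<in> hom_part X I deg j"
  shows "lin_ext act b f \<in> G j"
  unfolding lin_ext_def
proof (rule G_sum)
  fix k
  assume k: "k \<in> supp f"
  then have kI: "k \<in> I" and p: "coef f k \<in> poly_ring X"
    using f by (auto simp: hom_part_def free_mod_def)
  have deg: "deg k + mon_degree s = j" if "s \<in> supp (coef f k)" for s
    using f that by (auto simp: hom_part_def)
  obtain s where s: "s \<in> supp (coef f k)"
    using k by (metis keys_eq_empty all_not_in_conv in_keys_iff)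
  have "act (coef f k) (b k) \<in> G ((j - deg k) + deg k)"
  proof (rule G_act[OF p _ b[OF kI]])
    show "\<forall>s\<in>supp (coef f k). mon_degree s = j - deg k"
      using deg by force
  qed
  then show "act (coef f k) (b k) \<in> G j"
    using deg[OF s] by simp
qed

lemma lin_ext_M:
  assumes b: "\<And>k. k \<in> I \<Longrightarrow> b k \<in> M" and f: "f \<in> free_mod X I"
  shows "lin_ext act b f \<in> M"
  unfolding lin_ext_def
proof (rule M_sum)
  fix k
  assume "k \<in> supp f"
  with f have "k \<in> I" "coef f k \<in> poly_ring X" by (auto simp: free_mod_def)
  then show "act (coef f k) (b k) \<in> M" by (intro M_act b)
qed

lemma lin_ext_hcomp:
  assumes b: "\<And>k. k \<in> I \<Longrightarrow> b k \<in> G (deg k)" and f: "f \<in> free_mod X I"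
  shows "lin_ext act b (hcomp deg j f) = proj j (lin_ext act b f)"
  using f
proof (rule hcomp_commute[OF additive_lin_ext[OF module_act] additive_proj])
  fix i and f :: "nat \<Rightarrow>\<^sub>0 ('v, 'k) mpoly"
  assume "f \<in> hom_part X I deg i"
  with b have "lin_ext act b f \<in> G i" by (rule lin_ext_G)
  then show "proj j (lin_ext act b f) = (lin_ext act b f when i = j)" by (rule proj_G)
qed

end

locale graded_module = graded_act X "\<lambda>p m. poly_subst g p * m" M G proj
  for X :: "'v set" and g :: "'v \<Rightarrow> ('x, 'k::field) mpoly" and M G proj
begin

lemma homogeneous_aug_preimage:
  assumes C: "graded_free_resolution X g M G C" and m: "m \<in> G j"
  shows "\<exists>y\<in>hom_part X (gbasis C 0) (gdeg C 0) j. aug_map g C y = m"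
proof -
  obtain y where y: "y \<in> free_mod X (gbasis C 0)" "aug_map g C y = m"
    using aug_map_image[OF C] m G_subset by blast
  have "aug_map g C (hcomp (gdeg C 0) j y) = proj j (aug_map g C y)"
    unfolding aug_map_eq_lin_ext using gaug_in[OF C] y(1) by (rule lin_ext_hcomp)
  then have "aug_map g C (hcomp (gdeg C 0) j y) = m"
    using y(2) proj_G[OF m] by simp
  then show ?thesis using hcomp_hom_part[OF y(1)] by blast
qed

end

text \<open>
  The comparison theorem of homological algebra. As the source is free, the values on basis
  elements can be chosen one position at a time. The value at \<open>k\<close> must be a preimage of the element
  prescribed by the previous position; that element is a cycle because the differential of the
  source squares to zero, so exactness of the target provides the preimage. The target is a module
  over the source's ring through \<open>restrict F\<close>, and all choices can be made homogeneous.
\<close>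

lemma (in graded_module) chain_map_exists:
  fixes C :: "('v, 'x, 'k) free_complex" and C' :: "('v, 'y, 'k) free_complex"
  assumes C': "graded_free_resolution Y g' M' G' C'"
    and C: "graded_free_resolution X g M G C"
    and F: "face F" "\<And>p :: ('v, 'k) mpoly. p \<in> poly_ring Y \<Longrightarrow> restrict F p \<in> poly_ring X"
    and \<theta>: "additive \<theta>" "\<And>j m. m \<in> G' j \<Longrightarrow> \<theta> m \<in> G j"
      "\<And>p m. p \<in> poly_ring Y \<Longrightarrow> \<theta> (poly_subst g' p * m) = poly_subst g (restrict F p) * \<theta> m"
  shows "\<exists>\<phi>. (\<forall>i. \<forall>k\<in>gbasis C' i. \<phi> i k \<in> hom_part X (gbasis C i) (gdeg C i) (gdeg C' i k)) \<and>
    (\<forall>k\<in>gbasis C' 0. aug_map g C (\<phi> 0 k) = \<theta> (gaug C' k)) \<and>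
    (\<forall>i. \<forall>k\<in>gbasis C' (Suc i). diff_map C i (\<phi> (Suc i) k) = semilin F (\<phi> i) (gdiff C' i k))"
proof -
  \<comment> \<open>The last conjunct of \<open>P\<close> is what allows position \<open>i + 1\<close> to be filled.\<close>
  define P where "P i \<phi> \<longleftrightarrow>
    (\<forall>k\<in>gbasis C' i. \<phi> k \<in> hom_part X (gbasis C i) (gdeg C i) (gdeg C' i k)) \<and>
    (i = 0 \<longrightarrow> (\<forall>k\<in>gbasis C' 0. aug_map g C (\<phi> k) = \<theta> (gaug C' k))) \<and>
    (\<forall>k\<in>gbasis C' (Suc i). semilin F \<phi> (gdiff C' i k) \<in> cycles X g C i)" for i \<phi>
  define Q where "Q i \<phi> \<phi>' \<longleftrightarrow>
    (\<forall>k\<in>gbasis C' (Suc i). diff_map C i (\<phi>' k) = semilin F \<phi> (gdiff C' i k))" for i \<phi> \<phi>'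
  have hom: "semilin F \<phi> (gdiff C' i k) \<in> hom_part X (gbasis C i) (gdeg C i) (gdeg C' (Suc i) k)"
    if "k \<in> gbasis C' (Suc i)"
      "\<forall>k\<in>gbasis C' i. \<phi> k \<in> hom_part X (gbasis C i) (gdeg C i) (gdeg C' i k)" for i k \<phi>
    using that(2) by (intro semilin_hom_part[OF gdiff_hom_part[OF C' that(1)]] F(2)) auto
  have supp_gdiff: "l \<in> gbasis C' i" "coef (gdiff C' i k) l' \<in> poly_ring Y"
    if "k \<in> gbasis C' (Suc i)" "l \<in> supp (gdiff C' i k)" for i k l l'
    using gdiff_hom_part[OF C' that(1)] that(2) by (auto simp: hom_part_def free_mod_def)
  have "\<exists>\<phi>. P 0 \<phi>"
  proof -
    have "\<forall>k\<in>gbasis C' 0. \<exists>y. y \<in> hom_part X (gbasis C 0) (gdeg C 0) (gdeg C' 0 k) \<and>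
        aug_map g C y = \<theta> (gaug C' k)"
      using homogeneous_aug_preimage[OF C \<theta>(2)[OF gaug_in[OF C']]] by blast
    then obtain \<phi> where \<phi>: "\<forall>k\<in>gbasis C' 0. \<phi> k \<in> hom_part X (gbasis C 0) (gdeg C 0) (gdeg C' 0 k) \<and>
        aug_map g C (\<phi> k) = \<theta> (gaug C' k)"
      by metis
    have "semilin F \<phi> (gdiff C' 0 k) \<in> cycles X g C 0" if k: "k \<in> gbasis C' (Suc 0)" for k
    proof -
      let ?f = "gdiff C' 0 k"
      have "aug_map g C (semilin F \<phi> ?f)
          = (\<Sum>l\<in>supp ?f. poly_subst g (restrict F (coef ?f l)) * \<theta> (gaug C' l))"
        unfolding aug_map_semilin using \<phi> supp_gdiff(1)[OF k] by (intro sum.cong) auto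
      also have "\<dots> = (\<Sum>l\<in>supp ?f. \<theta> (poly_subst g' (coef ?f l) * gaug C' l))"
        using \<theta>(3) supp_gdiff(2)[OF k] by (intro sum.cong) auto
      also have "\<dots> = \<theta> (aug_map g' C' ?f)"
        by (simp add: aug_map_def additive.sum[OF \<theta>(1)])
      also have "\<dots> = 0"
        using gdiff_cycle[OF C' k] by (simp add: cycles_def additive.zero[OF \<theta>(1)])
      finally show ?thesis
        using hom[OF k] \<phi> by (auto simp: cycles_def hom_part_def)
    qed
    with \<phi> have "P 0 \<phi>" by (simp add: P_def)
    then show ?thesis by blast
  qed
  moreover have "\<exists>\<phi>'. P (Suc i) \<phi>' \<and> Q i \<phi> \<phi>'" if "P i \<phi>" for i \<phi>
  proof -
    have "\<forall>k\<in>gbasis C' (Suc i). \<exists>y. y \<in> hom_part X (gbasis C (Suc i)) (gdeg C (Suc i)) (gdeg C' (Suc i) k) \<and>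
        diff_map C i y = semilin F \<phi> (gdiff C' i k)"
      using that hom homogeneous_preimage[OF C] unfolding P_def by blast
    then obtain \<phi>' where \<phi>': "\<forall>k\<in>gbasis C' (Suc i).
        \<phi>' k \<in> hom_part X (gbasis C (Suc i)) (gdeg C (Suc i)) (gdeg C' (Suc i) k) \<and>
        diff_map C i (\<phi>' k) = semilin F \<phi> (gdiff C' i k)"
      by metis
    have "semilin F \<phi>' (gdiff C' (Suc i) k) \<in> cycles X g C (Suc i)"
      if k: "k \<in> gbasis C' (Suc (Suc i))" for k
    proof -
      let ?f = "gdiff C' (Suc i) k"
      have "diff_map C i (semilin F \<phi>' ?f) = semilin F (\<lambda>l. diff_map C i (\<phi>' l)) ?f"
        using F(1) by (simp add: diff_map_eq_semilin semilin_semilin)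
      also have "\<dots> = semilin F (\<lambda>l. semilin F \<phi> (gdiff C' i l)) ?f"
        using \<phi>' supp_gdiff(1)[OF k] by (intro semilin_cong) auto
      also have "\<dots> = semilin F \<phi> (diff_map C' i ?f)"
        using F(1) by (simp add: diff_map_eq_semilin semilin_semilin)
      also have "\<dots> = 0"
        using gdiff_cycle[OF C' k]
        by (simp add: cycles_def additive.zero[OF additive_semilin[OF F(1)]])
      finally show ?thesis
        using hom[OF k] \<phi>' by (auto simp: cycles_def hom_part_def)
    qed
    with \<phi>' have "P (Suc i) \<phi>' \<and> Q i \<phi> \<phi>'" by (simp add: P_def Q_def)
    then show ?thesis by blast
  qed
  ultimately obtain \<phi> where "\<forall>i. P i (\<phi> i) \<and> Q i (\<phi> i) (\<phi> (Suc i))"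
    using dependent_nat_choice[of P Q] by blast
  then show ?thesis by (intro exI[of _ \<phi>]) (auto simp: P_def Q_def)
qed

text \<open>
  Uniqueness of lifts up to homotopy, for the difference \<open>\<beta>\<close> of two lifts. Subtracting from \<open>\<beta>\<close> the
  part accounted for by the homotopy at the previous position leaves a cycle, hence a boundary,
  and a preimage of it is the next value of the homotopy.
\<close>

lemma null_homotopic:
  fixes C :: "('v, 'x, 'k::field) free_complex"
  assumes C: "graded_free_resolution X g M G C"
    and \<beta>: "\<And>i k. k \<in> gbasis C i \<Longrightarrow> \<beta> i k \<in> free_mod X (gbasis C i)"
    and \<beta>_aug: "\<And>k. k \<in> gbasis C 0 \<Longrightarrow> aug_map g C (\<beta> 0 k) = 0"
    and \<beta>_diff: "\<And>i k. k \<in> gbasis C (Suc i) \<Longrightarrow>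
      diff_map C i (\<beta> (Suc i) k) = semilin UNIV (\<beta> i) (gdiff C i k)"
  shows "\<exists>h. (\<forall>i. \<forall>k\<in>gbasis C i. h i k \<in> free_mod X (gbasis C (Suc i))) \<and>
    (\<forall>k\<in>gbasis C 0. \<beta> 0 k = diff_map C 0 (h 0 k)) \<and>
    (\<forall>i. \<forall>k\<in>gbasis C (Suc i).
      \<beta> (Suc i) k = diff_map C (Suc i) (h (Suc i) k) + semilin UNIV (h i) (gdiff C i k))"
proof -
  \<comment> \<open>The last conjunct of \<open>P\<close> says that the remainder at position \<open>i + 1\<close> is a cycle.\<close>
  define P where "P i h \<longleftrightarrow>
    (\<forall>k\<in>gbasis C i. h k \<in> free_mod X (gbasis C (Suc i))) \<and>
    (i = 0 \<longrightarrow> (\<forall>k\<in>gbasis C 0. \<beta> 0 k = diff_map C 0 (h k))) \<and>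
    (\<forall>k\<in>gbasis C (Suc i). semilin UNIV (\<lambda>l. \<beta> i l - diff_map C i (h l)) (gdiff C i k) = 0)" for i h
  define Q where "Q i h h' \<longleftrightarrow> (\<forall>k\<in>gbasis C (Suc i).
    \<beta> (Suc i) k = diff_map C (Suc i) (h' k) + semilin UNIV h (gdiff C i k))" for i h h'
  have zero: "semilin UNIV b 0 = 0" for b :: "nat \<Rightarrow> nat \<Rightarrow>\<^sub>0 ('v, 'k) mpoly"
    by (simp add: semilin_def lin_ext_def)
  have supp_gdiff: "l \<in> gbasis C i" if "k \<in> gbasis C (Suc i)" "l \<in> supp (gdiff C i k)" for i k l
    using gdiff_hom_part[OF C that(1)] that(2) by (auto simp: hom_part_def free_mod_def)
  have coef_gdiff: "coef (gdiff C i k) l \<in> poly_ring X" if "k \<in> gbasis C (Suc i)" for i k l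
    using gdiff_hom_part[OF C that(1)] by (auto simp: hom_part_def free_mod_def)
  have "\<exists>h. P 0 h"
  proof -
    have "\<forall>k\<in>gbasis C 0. \<exists>y. y \<in> free_mod X (gbasis C (Suc 0)) \<and> \<beta> 0 k = diff_map C 0 y"
      using \<beta> \<beta>_aug exactness[OF C, of 0] by (force simp: cycles_def)
    then obtain h where "\<forall>k\<in>gbasis C 0. h k \<in> free_mod X (gbasis C (Suc 0)) \<and> \<beta> 0 k = diff_map C 0 (h k)"
      by metis
    moreover from this have "semilin UNIV (\<lambda>l. \<beta> 0 l - diff_map C 0 (h l)) (gdiff C 0 k) = 0"
      if "k \<in> gbasis C (Suc 0)" for k
      using supp_gdiff[OF that] by (simp add: semilin_def lin_ext_def module.scale_zero_right[OF module_pscale])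
    ultimately have "P 0 h" by (simp add: P_def)
    then show ?thesis by blast
  qed
  moreover have "\<exists>h'. P (Suc i) h' \<and> Q i h h'" if h: "P i h" for i h
  proof -
    define r where "r k = \<beta> (Suc i) k - semilin UNIV h (gdiff C i k)" for k
    have "r k \<in> cycles X g C (Suc i)" if k: "k \<in> gbasis C (Suc i)" for k
    proof -
      have "semilin UNIV h (gdiff C i k) \<in> free_mod X (gbasis C (Suc i))"
        using h supp_gdiff[OF k] coef_gdiff[OF k]
        by (intro semilin_closed[where X = X]) (auto simp: P_def)
      moreover have "diff_map C i (r k)
          = semilin UNIV (\<lambda>l. \<beta> i l - diff_map C i (h l)) (gdiff C i k)"
        using \<beta>_diff[OF k]
        by (simp add: r_def diff_map_eq_semilin additive.diff[OF additive_semilin] semilin_semilin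
            semilin_diff_basis)
      ultimately show ?thesis
        using h \<beta>[OF k] k by (simp add: P_def cycles_def r_def free_mod_diff)
    qed
    then have "\<forall>k\<in>gbasis C (Suc i). \<exists>y. y \<in> free_mod X (gbasis C (Suc (Suc i))) \<and> r k = diff_map C (Suc i) y"
      using exactness[OF C, of "Suc i"] by blast
    then obtain h' where h': "\<forall>k\<in>gbasis C (Suc i).
        h' k \<in> free_mod X (gbasis C (Suc (Suc i))) \<and> r k = diff_map C (Suc i) (h' k)"
      by metis
    then have Q: "Q i h h'" unfolding Q_def r_def by (metis diff_add_cancel)
    have "semilin UNIV (\<lambda>l. \<beta> (Suc i) l - diff_map C (Suc i) (h' l)) (gdiff C (Suc i) k) = 0"
      if k: "k \<in> gbasis C (Suc (Suc i))" for k
    proof -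
      have "semilin UNIV (\<lambda>l. \<beta> (Suc i) l - diff_map C (Suc i) (h' l)) (gdiff C (Suc i) k)
          = semilin UNIV (\<lambda>l. semilin UNIV h (gdiff C i l)) (gdiff C (Suc i) k)"
        using Q supp_gdiff[OF k] by (intro semilin_cong) (simp add: Q_def)
      also have "\<dots> = semilin UNIV h (diff_map C i (gdiff C (Suc i) k))"
        by (simp add: diff_map_eq_semilin semilin_semilin)
      also have "\<dots> = 0"
        using gdiff_cycle[OF C k] by (simp add: cycles_def zero)
      finally show ?thesis .
    qed
    with Q h' have "P (Suc i) h' \<and> Q i h h'" by (simp add: P_def)
    then show ?thesis by blast
  qed
  ultimately obtain h where "\<forall>i. P i (h i) \<and> Q i (h i) (h (Suc i))"
    using dependent_nat_choice[of P Q] by blast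
  then show ?thesis by (intro exI[of _ h]) (auto simp: P_def Q_def)
qed

section \<open>Comparison of Tor\<close>

text \<open>
  \<open>const_part\<close> is the map from a free module \<open>F\<close> to \<open>F \<otimes> K\<close>, and \<open>const_lift\<close> is a section of it,
  which serves to transport identities between maps of free modules to the tensor products.
\<close>

definition const_part :: "(nat \<Rightarrow>\<^sub>0 ('v, 'k::field) mpoly) \<Rightarrow> (nat \<Rightarrow>\<^sub>0 'k)"
  where "const_part f = Poly_Mapping.map (\<lambda>p. coef p 0) f"

definition const_lift :: "(nat \<Rightarrow>\<^sub>0 'k::field) \<Rightarrow> (nat \<Rightarrow>\<^sub>0 ('v, 'k) mpoly)"
  where "const_lift f = Poly_Mapping.map const_poly f"

lemma lookup_const_part: "coef (const_part f) k = coef (coef f k) 0"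
  by (simp add: const_part_def map.rep_eq when_def)

lemma lookup_const_lift: "coef (const_lift f) k = const_poly (coef f k)"
  by (simp add: const_lift_def map.rep_eq when_def const_poly_def)

lemma const_part_const_lift: "const_part (const_lift f) = f"
  by (rule poly_mapping_eqI) (simp add: lookup_const_part lookup_const_lift const_poly_def)

lemma supp_const_part: "supp (const_part f) \<subseteq> supp f"
  by (auto simp: in_keys_iff lookup_const_part)

lemma additive_const_part: "additive const_part"
  by (auto simp: additive_def lookup_const_part lookup_add intro: poly_mapping_eqI)

lemma coef_mult_0:
  fixes p q :: "('v, 'k::field) mpoly"
  shows "coef (p * q) 0 = coef p 0 * coef q 0"
proof -
  have face: "face {0 :: 'v monomial}"
    using face_monomials[of "{}"] by simp
  have const: "restrict {0} r = Poly_Mapping.single 0 (coef r 0)" for r :: "('v, 'k) mpoly"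
    by (rule poly_mapping_eqI) (simp add: lookup_restrict lookup_single when_def)
  from restrict_mult[OF face, of p q]
  have "Poly_Mapping.single 0 (coef (p * q) 0)
      = (Poly_Mapping.single 0 (coef p 0 * coef q 0) :: ('v, 'k) mpoly)"
    by (simp add: const mult_single)
  then show ?thesis by (metis lookup_single_eq)
qed

lemma const_part_pscale: "const_part (pscale p f) = pscale (coef p 0) (const_part f)"
  by (rule poly_mapping_eqI) (simp add: lookup_const_part lookup_pscale coef_mult_0)

text \<open>The map of tensor products induced by the map of free modules with values \<open>b\<close> on the basis.\<close>

definition tensor_map ::
  "(nat \<Rightarrow> nat \<Rightarrow>\<^sub>0 ('v, 'k::field) mpoly) \<Rightarrow> (nat \<Rightarrow>\<^sub>0 'k) \<Rightarrow> (nat \<Rightarrow>\<^sub>0 'k)"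
  where "tensor_map b = lin_ext pscale (\<lambda>k. const_part (b k))"

lemma tensor_diff_eq_tensor_map: "tensor_diff C i = tensor_map (gdiff C i)"
  by (rule ext) (simp add: tensor_diff_def tensor_map_def lin_ext_def const_part_def)

lemma additive_tensor_map: "additive (tensor_map b)"
  unfolding tensor_map_def by (rule additive_lin_ext[OF module_pscale])

lemma tensor_map_pscale: "tensor_map b (pscale c f) = pscale c (tensor_map b f)"
  unfolding tensor_map_def by (rule lin_ext_pscale[OF module_pscale])

lemma tensor_map_cong:
  "(\<And>k. k \<in> supp f \<Longrightarrow> b k = c k) \<Longrightarrow> tensor_map b f = tensor_map c f"
  unfolding tensor_map_def by (rule lin_ext_cong) simp

lemma tensor_map_add_basis:
  "tensor_map (\<lambda>k. b k + c k) f = tensor_map b f + tensor_map c f"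
  by (simp add: tensor_map_def lin_ext_def additive.add[OF additive_const_part]
      module.scale_right_distrib[OF module_pscale] sum.distrib)

lemma tensor_map_basis:
  "tensor_map (\<lambda>k. Poly_Mapping.single k (1 :: ('v, 'k::field) mpoly)) f = f"
proof -
  have "const_part (Poly_Mapping.single k (1 :: ('v, 'k) mpoly)) = Poly_Mapping.single k 1" for k
    by (rule poly_mapping_eqI) (simp add: lookup_const_part lookup_single when_def)
  then show ?thesis by (simp add: tensor_map_def lin_ext_def pscale_single sum_singles)
qed

text \<open>
  A face contains the monomial \<open>1\<close>, so restricting scalars to it preserves constant terms: semilinear
  maps become honest linear maps after tensoring with \<open>K\<close>.
\<close>

lemma const_part_semilin:
  assumes "face F"
  shows "const_part (semilin F b f) = tensor_map b (const_part f)"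
proof -
  have "0 \<in> F" using assms by (simp add: face_def)
  then have "const_part (semilin F b f)
      = (\<Sum>k\<in>supp f. pscale (coef (const_part f) k) (const_part (b k)))"
    by (simp add: semilin_def additive_lin_ext_image[OF additive_const_part] const_part_pscale
        lookup_restrict lookup_const_part)
  also have "\<dots> = tensor_map b (const_part f)"
    by (simp add: tensor_map_def lin_ext_over_superset[OF module_pscale _ supp_const_part])
  finally show ?thesis .
qed

lemma tensor_map_tensor_map:
  fixes b :: "nat \<Rightarrow> nat \<Rightarrow>\<^sub>0 ('v, 'k::field) mpoly"
  assumes "face F"
  shows "tensor_map c (tensor_map b f) = tensor_map (\<lambda>k. semilin F c (b k)) f"
proof -
  let ?f = "const_lift f :: nat \<Rightarrow>\<^sub>0 ('v, 'k) mpoly"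
  have "tensor_map c (tensor_map b (const_part ?f)) = const_part (semilin F c (semilin F b ?f))"
    by (simp only: const_part_semilin[OF assms])
  also have "\<dots> = tensor_map (\<lambda>k. semilin F c (b k)) (const_part ?f)"
    by (simp add: semilin_semilin[OF assms assms] const_part_semilin[OF assms])
  finally show ?thesis by (simp add: const_part_const_lift)
qed

lemma supp_tensor_map: "supp (tensor_map b f) \<subseteq> (\<Union>k\<in>supp f. supp (const_part (b k)))"
proof -
  have "supp (tensor_map b f) \<subseteq> (\<Union>k\<in>supp f. supp (pscale (coef f k) (const_part (b k))))"
    unfolding tensor_map_def lin_ext_def by (rule keys_sum)
  also have "\<dots> \<subseteq> (\<Union>k\<in>supp f. supp (const_part (b k)))"
    by (rule UN_mono[OF subset_refl supp_pscale])
  finally show ?thesis .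
qed

lemma supp_const_part_hom_part:
  fixes f :: "nat \<Rightarrow>\<^sub>0 ('v, 'k::field) mpoly"
  assumes f: "f \<in> hom_part X I deg j"
  shows "supp (const_part f) \<subseteq> {k \<in> I. deg k = j}"
proof
  fix k
  assume k: "k \<in> supp (const_part f)"
  then have "0 \<in> supp (coef f k)" by (simp add: in_keys_iff lookup_const_part)
  then have "deg k + mon_degree (0 :: 'v monomial) = j" using f unfolding hom_part_def by blast
  moreover have "k \<in> I" using k f supp_const_part[of f] by (auto simp: hom_part_def free_mod_def)
  ultimately show "k \<in> {k \<in> I. deg k = j}" by simp
qed

lemma tensor_map_tensor_part:
  assumes "\<And>k. k \<in> gbasis C i \<Longrightarrow> b k \<in> hom_part Y (gbasis C' i') (gdeg C' i') (gdeg C i k)"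
    "f \<in> tensor_part C i j"
  shows "tensor_map b f \<in> tensor_part C' i' j"
proof -
  have "supp (const_part (b k)) \<subseteq> {l \<in> gbasis C' i'. gdeg C' i' l = j}" if "k \<in> supp f" for k
    using that assms(2) supp_const_part_hom_part[OF assms(1), of k] by (auto simp: tensor_part_def)
  then show ?thesis
    using supp_tensor_map[of b f] unfolding tensor_part_def by blast
qed

lemma tensor_map_restrict:
  assumes "\<And>k. k \<in> supp f \<Longrightarrow> supp (const_part (b k)) \<subseteq> {l. deg' l = deg k}"
  shows "tensor_map b (restrict {k. deg k = j} f) = restrict {l. deg' l = j} (tensor_map b f)"
proof -
  have comp: "restrict {l. deg' l = j} (const_part (b k)) = (const_part (b k) when deg k = j)"
    if "k \<in> supp f" for k
    using assms[OF that] by (auto simp: when_def intro!: restrict_id restrict_eq_0)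
  have "tensor_map b (restrict {k. deg k = j} f)
      = (\<Sum>k\<in>supp f. pscale (coef f k when deg k = j) (const_part (b k)))"
    unfolding tensor_map_def
    by (subst lin_ext_over_superset[OF module_pscale, where S = "supp f"])
      (auto simp: lookup_restrict supp_restrict)
  also have "\<dots> = (\<Sum>k\<in>supp f. pscale (coef f k) (restrict {l. deg' l = j} (const_part (b k))))"
    by (intro sum.cong) (auto simp: comp when_def module.scale_zero_left[OF module_pscale]
        module.scale_zero_right[OF module_pscale])
  also have "\<dots> = restrict {l. deg' l = j} (tensor_map b f)"
    by (simp add: tensor_map_def additive_lin_ext_image[OF additive_restrict] restrict_pscale)
  finally show ?thesis .
qed

text \<open>
  The preimage \<open>w\<close> may be inhomogeneous, as are those that come from a homotopy: since the
  differential preserves degrees, the component of degree \<open>j\<close> of \<open>w\<close> has the same image.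
\<close>

lemma boundary_of_degree:
  assumes C: "graded_free_resolution X g M G C"
    and w: "supp w \<subseteq> gbasis C (Suc i)" and z: "tensor_diff C i w \<in> tensor_part C i j"
  shows "tensor_diff C i w \<in> tor_boundaries C i j"
proof -
  let ?w = "restrict {k. gdeg C (Suc i) k = j} w"
  have "tensor_diff C i ?w = restrict {l. gdeg C i l = j} (tensor_diff C i w)"
    unfolding tensor_diff_eq_tensor_map
    using w supp_const_part_hom_part[OF gdiff_hom_part[OF C]]
    by (intro tensor_map_restrict) blast
  also have "\<dots> = tensor_diff C i w"
    using z by (intro restrict_id) (auto simp: tensor_part_def)
  finally have "tensor_diff C i w = tensor_diff C i ?w" ..
  moreover have "?w \<in> tensor_part C (Suc i) j"
    using w by (auto simp: tensor_part_def supp_restrict)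
  ultimately show ?thesis by (auto simp: tor_boundaries_def)
qed

lemma supp_tensor_map_subset:
  assumes "\<And>k. k \<in> I \<Longrightarrow> b k \<in> free_mod X I'" "supp f \<subseteq> I"
  shows "supp (tensor_map b f) \<subseteq> I'"
proof -
  have "supp (const_part (b k)) \<subseteq> I'" if "k \<in> supp f" for k
    using assms(1)[of k] that assms(2) supp_const_part[of "b k"] unfolding free_mod_def by blast
  then show ?thesis using supp_tensor_map[of b f] by blast
qed

text \<open>Boundaries are cycles because the differentials of the resolution compose to zero.\<close>

lemma tensor_diff_tensor_diff:
  fixes C :: "('v, 'x, 'k::field) free_complex"
  assumes C: "graded_free_resolution X g M G C" and f: "supp f \<subseteq> gbasis C (Suc (Suc i))"
  shows "tensor_diff C i (tensor_diff C (Suc i) f) = 0"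
proof -
  have "tensor_diff C i (tensor_diff C (Suc i) f)
      = tensor_map (\<lambda>k. semilin UNIV (gdiff C i) (gdiff C (Suc i) k)) f"
    by (simp add: tensor_diff_eq_tensor_map tensor_map_tensor_map[OF face_UNIV])
  also have "\<dots> = tensor_map (\<lambda>k. 0 :: nat \<Rightarrow>\<^sub>0 ('v, 'k) mpoly) f"
  proof (rule tensor_map_cong)
    fix k
    assume "k \<in> supp f"
    with f have "gdiff C (Suc i) k \<in> cycles X g C (Suc i)" by (intro gdiff_cycle[OF C]) blast
    then show "semilin UNIV (gdiff C i) (gdiff C (Suc i) k) = 0"
      by (simp add: cycles_def diff_map_eq_semilin)
  qed
  also have "\<dots> = 0"
    by (simp add: tensor_map_def lin_ext_def additive.zero[OF additive_const_part]
        module.scale_zero_right[OF module_pscale])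
  finally show ?thesis .
qed

lemma tensor_map_hom:
  "module_hom pscale pscale (tensor_map b)"
  by (simp add: module_hom_iff module_pscale additive.add[OF additive_tensor_map] tensor_map_pscale)

lemma subspace_tensor_part: "module.subspace pscale (tensor_part C i j)"
  using Poly_Mapping.keys_add supp_pscale
  by (fastforce simp: module.subspace_def[OF module_pscale] tensor_part_def)

lemma subspace_tor_cycles: "module.subspace pscale (tor_cycles C i j)"
proof (cases i)
  case 0
  then show ?thesis using subspace_tensor_part[of C 0 j] by (simp add: tor_cycles_def)
next
  case (Suc l)
  show ?thesis
    using subspace_tensor_part[of C i j]
    by (simp add: Suc module.subspace_def[OF module_pscale] tor_cycles_def
        tensor_diff_eq_tensor_map additive.add[OF additive_tensor_map] tensor_map_pscale
        additive.zero[OF additive_tensor_map] module.scale_zero_right[OF module_pscale])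
qed

lemma subspace_tor_boundaries: "module.subspace pscale (tor_boundaries C i j)"
  unfolding tor_boundaries_def tensor_diff_eq_tensor_map
  by (rule module_hom.subspace_image[OF tensor_map_hom subspace_tensor_part])

lemma tor_boundaries_subset:
  assumes C: "graded_free_resolution X g M G C"
  shows "tor_boundaries C i j \<subseteq> tor_cycles C i j"
proof
  fix z
  assume "z \<in> tor_boundaries C i j"
  then obtain w where w: "w \<in> tensor_part C (Suc i) j" "z = tensor_diff C i w"
    by (auto simp: tor_boundaries_def)
  have "z \<in> tensor_part C i j"
    unfolding w(2) tensor_diff_eq_tensor_map
    using gdiff_hom_part[OF C] w(1) by (rule tensor_map_tensor_part)
  moreover have "tensor_diff C l z = 0" if "i = Suc l" for l
    using w that tensor_diff_tensor_diff[OF C, of w l] by (auto simp: tensor_part_def)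
  ultimately show "z \<in> tor_cycles C i j"
    by (auto simp: tor_cycles_def split: nat.split)
qed

lemma tensor_part_finite_dim:
  fixes C :: "('v, 'x, 'k::field) free_complex"
  assumes "graded_free_resolution X g M G C"
  shows "\<exists>S. finite S \<and> tensor_part C i j \<subseteq> module.span pscale S"
proof (intro exI conjI)
  let ?I = "{k \<in> gbasis C i. gdeg C i k = j}"
  let ?S = "(\<lambda>k. Poly_Mapping.single k (1::'k)) ` ?I"
  show "finite ?S" using assms by (auto simp: graded_free_resolution_def)
  show "tensor_part C i j \<subseteq> module.span pscale ?S"
  proof
    fix f
    assume f: "f \<in> tensor_part C i j"
    have "(\<Sum>k\<in>supp f. pscale (coef f k) (Poly_Mapping.single k 1)) \<in> module.span pscale ?S"
      using f by (intro module.span_sum[OF module_pscale] module.span_scale[OF module_pscale]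
          module.span_base[OF module_pscale]) (auto simp: tensor_part_def)
    then show "f \<in> module.span pscale ?S" by (simp add: pscale_single sum_singles)
  qed
qed

text \<open>
  The dimension inequality for the embedding of \<open>Z/B\<close> into \<open>Z'/B'\<close> that \<open>L\<close> induces: extend a basis
  \<open>b\<close> of \<open>B\<close> to a basis \<open>c\<close> of \<open>Z\<close>; then the images of \<open>c - b\<close> are independent modulo \<open>B'\<close>.
\<close>

lemma (in vector_space) dim_quotient_le:
  assumes L: "module_hom scale scale L"
    and Z: "subspace Z" "finite S" "Z \<subseteq> span S" and B: "subspace B" "B \<subseteq> Z"
    and Z': "subspace Z'" "finite S'" "Z' \<subseteq> span S'" and B': "subspace B'" "B' \<subseteq> Z'"
    and maps: "\<And>z. z \<in> Z \<Longrightarrow> L z \<in> Z'" and pulls: "\<And>z. z \<in> Z \<Longrightarrow> L z \<in> B' \<Longrightarrow> z \<in> B"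
  shows "dim Z - dim B \<le> dim Z' - dim B'"
proof -
  interpret L: module_hom scale scale L by (rule L)
  obtain b where b: "b \<subseteq> B" "independent b" "B \<subseteq> span b"
    using maximal_independent_subset by metis
  obtain c where c: "b \<subseteq> c" "c \<subseteq> Z" "independent c" "Z \<subseteq> span c"
    using maximal_independent_subset_extend[of b Z, OF subset_trans[OF b(1) B(2)] b(2)] by metis
  obtain b' where b': "b' \<subseteq> B'" "independent b'" "B' \<subseteq> span b'"
    using maximal_independent_subset by metis
  have "c \<subseteq> span S" "b' \<subseteq> span S'" using c(2) Z(3) b'(1) B'(2) Z'(3) by blast+
  then have fin: "finite c" "finite b'"
    using independent_span_bound[OF Z(2) c(3)] independent_span_bound[OF Z'(2) b'(2)] by blast+
  have dims: "dim B = card b" "dim Z = card c" "dim B' = card b'"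
    using dim_unique[OF b(1,3,2) refl] dim_unique[OF c(2,4,3) refl] dim_unique[OF b'(1,3,2) refl]
    by simp_all
  have span_b': "span b' = B'" using span_minimal[OF b'(1) B'(1)] b'(3) by blast
  have "independent (b' \<union> L ` D) \<and> card (b' \<union> L ` D) = card b' + card D"
    if "finite D" "D \<subseteq> c - b" for D
    using that
  proof (induction D rule: finite_induct)
    case empty
    then show ?case using b' by simp
  next
    case (insert x D)
    have "L x \<notin> span (b' \<union> L ` D)"
    proof
      assume "L x \<in> span (b' \<union> L ` D)"
      then have "L x \<in> {x + y |x y. x \<in> span b' \<and> y \<in> L ` span D}"
        by (simp only: span_Un L.span_image)
      then obtain u v where uv: "u \<in> span b'" "v \<in> span D" "L x = u + L v"
        by blast
      have "D \<subseteq> Z" using insert.prems c by blast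
      then have "v \<in> Z" using uv(2) span_minimal[OF _ Z(1)] by blast
      then have "x - v \<in> Z" using insert.prems c(2) by (intro subspace_diff[OF Z(1)]) blast+
      moreover have "L (x - v) \<in> B'" using uv span_b' by (simp add: L.diff)
      ultimately have v: "x - v \<in> span b" using pulls b(3) by (metis subsetD)
      have "b \<subseteq> c - {x}" "D \<subseteq> c - {x}"
        using insert.prems insert.hyps c(1) by blast+
      then have "x - v \<in> span (c - {x})" "v \<in> span (c - {x})"
        using uv(2) v by (metis span_mono subsetD)+
      then have "(x - v) + v \<in> span (c - {x})" by (rule span_add)
      moreover have "x \<in> c" using insert.prems by blast
      ultimately show False using c(3) unfolding dependent_def by auto
    qed
    moreover from this have "L x \<notin> b' \<union> L ` D" by (metis span_base)
    moreover have "independent (b' \<union> L ` D)" "card (b' \<union> L ` D) = card b' + card D"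
      using insert.IH insert.prems by simp_all
    ultimately show ?case
      using insert.hyps fin by (simp add: independent_insertI)
  qed
  from this[of "c - b"] have indep: "independent (b' \<union> L ` (c - b))"
    and card: "card (b' \<union> L ` (c - b)) = card b' + (card c - card b)"
    using fin(1) finite_subset[OF c(1) fin(1)] c(1) by (simp_all add: card_Diff_subset)
  obtain e where e: "b' \<union> L ` (c - b) \<subseteq> e" "e \<subseteq> Z'" "independent e" "Z' \<subseteq> span e"
  proof (rule maximal_independent_subset_extend[OF _ indep, of Z'])
    show "b' \<union> L ` (c - b) \<subseteq> Z'" using b'(1) B'(2) c(2) maps by blast
  qed
  have "finite e" using independent_span_bound[OF Z'(2) e(3)] e(2) Z'(3) by blast
  then have "card b' + (card c - card b) \<le> card e" using card e(1) by (metis card_mono)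
  moreover have "dim Z' = card e" using dim_unique[OF e(2,4,3) refl] .
  ultimately show ?thesis using dims by simp
qed

text \<open>
  The chain maps \<open>\<phi>\<close> lifting \<open>\<iota>\<close> and \<open>\<psi>\<close> lifting \<open>\<pi>\<close> compose to a lift of the identity of \<open>N\<close>, which is
  homotopic to the identity. So a cycle \<open>z\<close> with \<open>\<phi> z\<close> a boundary is itself a boundary, being
  homologous to the boundary \<open>\<psi> (\<phi> z)\<close>; that is, \<open>\<phi>\<close> is injective on Tor. All maps are considered
  semilinear along the same \<open>restrict F\<close>, which is the identity on \<open>poly_ring Y\<close>.
\<close>

lemma tor_dim_le_of_retract:
  fixes C :: "('v, 'x, 'k::field) free_complex" and C' :: "('v, 'y, 'k) free_complex"
  assumes N: "graded_module Y h N H proj'" and M: "graded_module X g M G proj"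
    and C: "graded_free_resolution X g M G C" and C': "graded_free_resolution Y h N H C'"
    and F: "face F" "{s. supp s \<subseteq> Y} \<subseteq> F"
      "\<And>p :: ('v, 'k) mpoly. p \<in> poly_ring X \<Longrightarrow> restrict F p \<in> poly_ring Y"
      "\<And>p :: ('v, 'k) mpoly. p \<in> poly_ring Y \<Longrightarrow> restrict F p \<in> poly_ring X"
    and \<iota>: "additive \<iota>" "\<And>j m. m \<in> H j \<Longrightarrow> \<iota> m \<in> G j"
      "\<And>p m. p \<in> poly_ring Y \<Longrightarrow> \<iota> (poly_subst h p * m) = poly_subst g (restrict F p) * \<iota> m"
    and \<pi>: "additive \<pi>" "\<And>j m. m \<in> G j \<Longrightarrow> \<pi> m \<in> H j"
      "\<And>p m. p \<in> poly_ring X \<Longrightarrow> \<pi> (poly_subst g p * m) = poly_subst h (restrict F p) * \<pi> m"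
    and retract: "\<And>m. m \<in> N \<Longrightarrow> \<pi> (\<iota> m) = m"
  shows "vector_space.dim pscale (tor_cycles C' i j) - vector_space.dim pscale (tor_boundaries C' i j)
    \<le> vector_space.dim pscale (tor_cycles C i j) - vector_space.dim pscale (tor_boundaries C i j)"
proof -
  interpret N: graded_module Y h N H proj' by (rule N)
  obtain \<phi> where \<phi>: "\<And>i k. k \<in> gbasis C' i \<Longrightarrow> \<phi> i k \<in> hom_part X (gbasis C i) (gdeg C i) (gdeg C' i k)"
    and \<phi>_aug: "\<And>k. k \<in> gbasis C' 0 \<Longrightarrow> aug_map g C (\<phi> 0 k) = \<iota> (gaug C' k)"
    and \<phi>_diff: "\<And>i k. k \<in> gbasis C' (Suc i) \<Longrightarrow>
      diff_map C i (\<phi> (Suc i) k) = semilin F (\<phi> i) (gdiff C' i k)"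
    using graded_module.chain_map_exists[OF M C' C F(1) F(4) \<iota>] by blast
  obtain \<psi> where \<psi>: "\<And>i k. k \<in> gbasis C i \<Longrightarrow> \<psi> i k \<in> hom_part Y (gbasis C' i) (gdeg C' i) (gdeg C i k)"
    and \<psi>_aug: "\<And>k. k \<in> gbasis C 0 \<Longrightarrow> aug_map h C' (\<psi> 0 k) = \<pi> (gaug C k)"
    and \<psi>_diff: "\<And>i k. k \<in> gbasis C (Suc i) \<Longrightarrow>
      diff_map C' i (\<psi> (Suc i) k) = semilin F (\<psi> i) (gdiff C i k)"
    using graded_module.chain_map_exists[OF N C C' F(1) F(3) \<pi>] by blast
  have \<phi>_supp: "l \<in> gbasis C i" "coef (\<phi> i k) l' \<in> poly_ring X"
    if "k \<in> gbasis C' i" "l \<in> supp (\<phi> i k)" for i k l l'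
    using \<phi>[OF that(1)] that(2) by (auto simp: hom_part_def free_mod_def)
  have coef_gdiff: "coef (gdiff C' i k) l \<in> poly_ring Y" if "k \<in> gbasis C' (Suc i)" for i k l
    using gdiff_hom_part[OF C' that] by (auto simp: hom_part_def free_mod_def)

  \<comment> \<open>The difference of two lifts of the identity of \<open>N\<close>; it is null-homotopic by a homotopy \<open>s\<close>.\<close>
  define \<beta> where "\<beta> i k = semilin F (\<psi> i) (\<phi> i k) - Poly_Mapping.single k 1" for i k
  have \<beta>_free: "\<beta> i k \<in> free_mod Y (gbasis C' i)" if k: "k \<in> gbasis C' i" for i k
    unfolding \<beta>_def
  proof (intro free_mod_diff free_mod_single k)
    show "semilin F (\<psi> i) (\<phi> i k) \<in> free_mod Y (gbasis C' i)"
      using semilin_hom_part[OF \<phi>[OF k] \<psi> F(3)] by (rule hom_part_free_mod)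
    show "1 \<in> poly_ring Y" by (simp add: poly_ring_def)
  qed
  have \<beta>_aug: "aug_map h C' (\<beta> 0 k) = 0" if k: "k \<in> gbasis C' 0" for k
  proof -
    let ?f = "\<phi> 0 k"
    have "aug_map h C' (semilin F (\<psi> 0) ?f)
        = (\<Sum>l\<in>supp ?f. poly_subst h (restrict F (coef ?f l)) * \<pi> (gaug C l))"
      unfolding aug_map_semilin using \<psi>_aug \<phi>_supp(1)[OF k] by (intro sum.cong) auto
    also have "\<dots> = (\<Sum>l\<in>supp ?f. \<pi> (poly_subst g (coef ?f l) * gaug C l))"
      using \<pi>(3) \<phi>_supp(2)[OF k] by (intro sum.cong) auto
    also have "\<dots> = \<pi> (aug_map g C ?f)"
      by (simp add: aug_map_def additive.sum[OF \<pi>(1)])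
    also have "\<dots> = gaug C' k"
      using \<phi>_aug[OF k] retract gaug_in[OF C' k] N.G_subset by auto
    also have "\<dots> = aug_map h C' (Poly_Mapping.single k 1)"
      by (simp add: aug_map_eq_lin_ext lin_ext_single[OF module_poly_subst] poly_subst_one)
    finally show ?thesis by (simp add: \<beta>_def additive.diff[OF additive_aug_map])
  qed
  have \<beta>_diff: "diff_map C' i (\<beta> (Suc i) k) = semilin UNIV (\<beta> i) (gdiff C' i k)"
    if k: "k \<in> gbasis C' (Suc i)" for i k
  proof -
    have "diff_map C' i (semilin F (\<psi> (Suc i)) (\<phi> (Suc i) k))
        = semilin F (\<lambda>l. diff_map C' i (\<psi> (Suc i) l)) (\<phi> (Suc i) k)"
      using F(1) by (simp add: diff_map_eq_semilin semilin_semilin)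
    also have "\<dots> = semilin F (\<lambda>l. semilin F (\<psi> i) (gdiff C i l)) (\<phi> (Suc i) k)"
      using \<psi>_diff \<phi>_supp(1)[OF k] by (intro semilin_cong) auto
    also have "\<dots> = semilin F (\<psi> i) (diff_map C i (\<phi> (Suc i) k))"
      using F(1) by (simp add: diff_map_eq_semilin semilin_semilin)
    also have "\<dots> = semilin F (\<lambda>l. semilin F (\<psi> i) (\<phi> i l)) (gdiff C' i k)"
      using F(1) \<phi>_diff[OF k] by (simp add: semilin_semilin)
    also have "\<dots> = semilin UNIV (\<lambda>l. semilin F (\<psi> i) (\<phi> i l)) (gdiff C' i k)"
      using coef_gdiff[OF k] F(2) by (rule semilin_fixed)
    finally show ?thesis
      by (simp add: \<beta>_def[abs_def] semilin_diff_basis semilin_basis diff_map_eq_semilin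
          additive.diff[OF additive_semilin] semilin_single module.scale_one[OF module_pscale])
  qed
  obtain s where s: "\<And>i k. k \<in> gbasis C' i \<Longrightarrow> s i k \<in> free_mod Y (gbasis C' (Suc i))"
    and s_0: "\<And>k. k \<in> gbasis C' 0 \<Longrightarrow> \<beta> 0 k = diff_map C' 0 (s 0 k)"
    and s_Suc: "\<And>i k. k \<in> gbasis C' (Suc i) \<Longrightarrow>
      \<beta> (Suc i) k = diff_map C' (Suc i) (s (Suc i) k) + semilin UNIV (s i) (gdiff C' i k)"
    using null_homotopic[OF C' \<beta>_free \<beta>_aug \<beta>_diff] by blast

  have \<phi>_cycle: "tensor_map (\<phi> i) z \<in> tor_cycles C i j" if z: "z \<in> tor_cycles C' i j" for z
  proof -
    have part: "tensor_map (\<phi> i) z \<in> tensor_part C i j"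
      using \<phi> z by (intro tensor_map_tensor_part[of C']) (auto simp: tor_cycles_def)
    have "tensor_diff C l (tensor_map (\<phi> i) z) = 0" if i: "i = Suc l" for l
    proof -
      have supp: "supp z \<subseteq> gbasis C' (Suc l)" "tensor_diff C' l z = 0"
        using z i by (auto simp: tor_cycles_def tensor_part_def)
      have "tensor_diff C l (tensor_map (\<phi> i) z)
          = tensor_map (\<lambda>k. diff_map C l (\<phi> (Suc l) k)) z"
        by (simp add: i tensor_diff_eq_tensor_map tensor_map_tensor_map[OF face_UNIV] diff_map_eq_semilin)
      also have "\<dots> = tensor_map (\<lambda>k. semilin F (\<phi> l) (gdiff C' l k)) z"
        using \<phi>_diff supp(1) by (intro tensor_map_cong) auto
      also have "\<dots> = tensor_map (\<phi> l) (tensor_diff C' l z)"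
        by (simp add: tensor_diff_eq_tensor_map tensor_map_tensor_map[OF F(1)])
      finally show ?thesis using supp(2) by (simp add: additive.zero[OF additive_tensor_map])
    qed
    with part show ?thesis by (auto simp: tor_cycles_def split: nat.split)
  qed

  have \<phi>_boundary: "z \<in> tor_boundaries C' i j"
    if z: "z \<in> tor_cycles C' i j" and b: "tensor_map (\<phi> i) z \<in> tor_boundaries C i j" for z
  proof -
    have z_supp: "supp z \<subseteq> gbasis C' i" and z_part: "z \<in> tensor_part C' i j"
      using z by (auto simp: tor_cycles_def tensor_part_def)
    obtain y where y: "supp y \<subseteq> gbasis C (Suc i)" "tensor_map (\<phi> i) z = tensor_diff C i y"
      using b by (auto simp: tor_boundaries_def tensor_part_def)
    have "tensor_map (\<psi> i) (tensor_map (\<phi> i) z)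
        = tensor_map (\<lambda>k. \<beta> i k + Poly_Mapping.single k 1) z"
      by (simp add: tensor_map_tensor_map[OF F(1)] \<beta>_def)
    then have comp: "tensor_map (\<psi> i) (tensor_map (\<phi> i) z) = tensor_map (\<beta> i) z + z"
      by (simp add: tensor_map_add_basis tensor_map_basis)
    \<comment> \<open>The other term of the homotopy formula vanishes, as \<open>z\<close> is a cycle.\<close>
    have \<beta>z: "tensor_map (\<beta> i) z = tensor_diff C' i (tensor_map (s i) z)"
    proof (cases i)
      case 0
      then have "tensor_map (\<beta> i) z = tensor_map (\<lambda>k. diff_map C' 0 (s 0 k)) z"
        using s_0 z_supp by (auto intro: tensor_map_cong)
      then show ?thesis
        by (simp add: 0 tensor_diff_eq_tensor_map tensor_map_tensor_map[OF face_UNIV] diff_map_eq_semilin)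
    next
      case (Suc l)
      have "tensor_map (\<beta> i) z = tensor_map (\<lambda>k. diff_map C' (Suc l) (s (Suc l) k)
          + semilin UNIV (s l) (gdiff C' l k)) z"
        using s_Suc z_supp Suc by (intro tensor_map_cong) auto
      also have "\<dots> = tensor_diff C' i (tensor_map (s i) z) + tensor_map (s l) (tensor_diff C' l z)"
        by (simp add: Suc tensor_map_add_basis tensor_diff_eq_tensor_map
            tensor_map_tensor_map[OF face_UNIV] diff_map_eq_semilin)
      also have "tensor_diff C' l z = 0" using z Suc by (simp add: tor_cycles_def)
      finally show ?thesis by (simp add: additive.zero[OF additive_tensor_map])
    qed
    have "tensor_map (\<psi> i) (tensor_diff C i y)
        = tensor_map (\<lambda>k. semilin F (\<psi> i) (gdiff C i k)) y"
      by (simp add: tensor_diff_eq_tensor_map tensor_map_tensor_map[OF F(1)])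
    also have "\<dots> = tensor_map (\<lambda>k. diff_map C' i (\<psi> (Suc i) k)) y"
      using \<psi>_diff y(1) by (intro tensor_map_cong) auto
    also have "\<dots> = tensor_diff C' i (tensor_map (\<psi> (Suc i)) y)"
      by (simp add: tensor_diff_eq_tensor_map tensor_map_tensor_map[OF face_UNIV] diff_map_eq_semilin)
    finally have "z = tensor_diff C' i (tensor_map (\<psi> (Suc i)) y) - tensor_diff C' i (tensor_map (s i) z)"
      using comp y(2) \<beta>z by (simp add: algebra_simps)
    then have z_eq: "z = tensor_diff C' i (tensor_map (\<psi> (Suc i)) y - tensor_map (s i) z)" (is "_ = tensor_diff C' i ?w")
      by (simp add: tensor_diff_eq_tensor_map additive.diff[OF additive_tensor_map])
    have "supp (tensor_map (\<psi> (Suc i)) y) \<subseteq> gbasis C' (Suc i)"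
      by (rule supp_tensor_map_subset[OF hom_part_free_mod[OF \<psi>] y(1)])
    moreover have "supp (tensor_map (s i) z) \<subseteq> gbasis C' (Suc i)"
      using s z_supp by (rule supp_tensor_map_subset)
    ultimately have "supp ?w \<subseteq> gbasis C' (Suc i)"
      by (rule subset_trans[OF keys_diff Un_least])
    then show ?thesis using boundary_of_degree[OF C'] z_eq z_part by metis
  qed

  obtain S S' where S: "finite S" "tensor_part C i j \<subseteq> module.span pscale S"
    and S': "finite S'" "tensor_part C' i j \<subseteq> module.span pscale S'"
    using tensor_part_finite_dim[OF C] tensor_part_finite_dim[OF C'] by metis
  have parts: "tor_cycles C i j \<subseteq> tensor_part C i j" "tor_cycles C' i j \<subseteq> tensor_part C' i j"
    by (auto simp: tor_cycles_def)
  show ?thesis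
    using S(2) S'(2) parts
    by (intro vector_space.dim_quotient_le[OF vector_space_pscale tensor_map_hom
          subspace_tor_cycles S'(1) _ subspace_tor_boundaries tor_boundaries_subset[OF C']
          subspace_tor_cycles S(1) _ subspace_tor_boundaries tor_boundaries_subset[OF C]
          \<phi>_cycle \<phi>_boundary]) auto
qed

section \<open>Existence of graded free resolutions\<close>

text \<open>
  Bases are indexed by sets of natural numbers, so the \<open>a\<close>-th generator of degree \<open>j\<close> gets the index
  \<open>prod_encode (j, a)\<close>.
\<close>

lemma index_finite_families:
  assumes "\<And>j::nat. finite (S j)"
  shows "\<exists>I deg (b :: nat \<Rightarrow> 'm). \<forall>j. finite {k\<in>I. deg k = j} \<and> b ` {k\<in>I. deg k = j} = S j"
proof -
  have "\<forall>j. \<exists>(n::nat) e. S j = e ` {i. i < n}"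
    using assms finite_imp_nat_seg_image_inj_on by metis
  then obtain n e where S: "\<And>j. S j = e j ` {i::nat. i < n j}" by metis
  define I where "I = {k. snd (prod_decode k) < n (fst (prod_decode k))}"
  define deg where "deg k = fst (prod_decode k)" for k
  define b where "b k = e (fst (prod_decode k)) (snd (prod_decode k))" for k
  have part: "{k\<in>I. deg k = j} = (\<lambda>a. prod_encode (j, a)) ` {i. i < n j}" for j
  proof (intro set_eqI iffI)
    fix k
    assume "k \<in> {k\<in>I. deg k = j}"
    then have k: "snd (prod_decode k) < n j" "j = fst (prod_decode k)"
      by (auto simp: I_def deg_def)
    then have "k = prod_encode (j, snd (prod_decode k))"
      by (simp add: prod_decode_inverse)
    with k(1) show "k \<in> (\<lambda>a. prod_encode (j, a)) ` {i. i < n j}" by blast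
  qed (auto simp: I_def deg_def)
  have "b ` {k\<in>I. deg k = j} = S j" for j
    by (simp add: part S image_image b_def)
  moreover have "finite {k\<in>I. deg k = j}" for j
    by (simp add: part)
  ultimately show ?thesis by blast
qed

lemma sum_closed:
  assumes "0 \<in> R" "\<And>m m'. m \<in> R \<Longrightarrow> m' \<in> R \<Longrightarrow> m + m' \<in> R" "\<And>a. a \<in> A \<Longrightarrow> h a \<in> R"
  shows "sum h A \<in> R"
  using assms by (induction A rule: infinite_finite_induct) auto

text \<open>
  Finite spanning sets of all graded components together generate the module, and they have
  finitely many elements in each degree.
\<close>

lemma (in graded_act) free_cover_exists:
  "\<exists>I deg b. (\<forall>j. finite {k\<in>I. deg k = j}) \<and> (\<forall>k\<in>I. b k \<in> G (deg k)) \<and>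
    lin_ext act b ` free_mod X I = M"
proof -
  have "\<forall>j. \<exists>S. finite S \<and> S \<subseteq> G j \<and> (\<forall>m\<in>G j. \<exists>c. m = (\<Sum>b\<in>S. act (const_poly (c b)) b))"
    using finite_dim_G by blast
  from choice[OF this] obtain S where S_all: "\<forall>j. finite (S j) \<and> S j \<subseteq> G j \<and>
      (\<forall>m\<in>G j. \<exists>c. m = (\<Sum>b\<in>S j. act (const_poly (c b)) b))"
    by blast
  then have S: "\<And>j. finite (S j)" "\<And>j. S j \<subseteq> G j"
    and span: "\<And>j m. m \<in> G j \<Longrightarrow> \<exists>c. m = (\<Sum>b\<in>S j. act (const_poly (c b)) b)"
    by blast+
  obtain I :: "nat set" and deg b where Ib: "\<forall>j. finite {k\<in>I. deg k = j} \<and> b ` {k\<in>I. deg k = j} = S j"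
    using index_finite_families[of S, OF S(1)] by blast
  then have I: "\<And>j. finite {k\<in>I. deg k = j}" and b: "\<And>j. b ` {k\<in>I. deg k = j} = S j"
    by blast+
  have b_G: "b k \<in> G (deg k)" if "k \<in> I" for k
  proof -
    have "b k \<in> b ` {l \<in> I. deg l = deg k}" using that by blast
    then show ?thesis unfolding b using S(2) by blast
  qed
  let ?R = "lin_ext act b ` free_mod X I"
  have "lin_ext act b f \<in> M" if "f \<in> free_mod X I" for f
    using that by (intro lin_ext_M[where I = I]) (use b_G G_subset in \<open>metis subsetD\<close>)
  then have "?R \<subseteq> M" by blast
  moreover have R_add: "m + m' \<in> ?R" if "m \<in> ?R" "m' \<in> ?R" for m m'
  proof -
    obtain f f' where "f \<in> free_mod X I" "m = lin_ext act b f" "f' \<in> free_mod X I" "m' = lin_ext act b f'"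
      using \<open>m \<in> ?R\<close> \<open>m' \<in> ?R\<close> by blast
    then show ?thesis
      by (intro image_eqI[of _ _ "f + f'"]) (simp_all add: lin_ext_add[OF module_act] free_mod_add)
  qed
  have R_0: "0 \<in> ?R"
    by (intro image_eqI[of _ _ 0]) (simp_all add: lin_ext_def)
  have G_R: "G j \<subseteq> ?R" for j
  proof
    fix m
    assume "m \<in> G j"
    then obtain c where m: "m = (\<Sum>b\<in>S j. act (const_poly (c b)) b)" using span by blast
    show "m \<in> ?R"
      unfolding m
    proof (rule sum_closed[OF R_0 R_add])
      fix a
      assume "a \<in> S j"
      then obtain k where k: "k \<in> I" "a = b k" using b by blast
      have "act (const_poly (c a)) a = lin_ext act b (Poly_Mapping.single k (const_poly (c a)))"
        by (simp add: k(2) lin_ext_single[OF module_act])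
      then show "act (const_poly (c a)) a \<in> ?R"
        using free_mod_single[OF k(1) poly_ring_const] by blast
    qed
  qed
  have "M \<subseteq> ?R"
  proof
    fix m
    assume m: "m \<in> M"
    then obtain J where "(\<Sum>j\<in>J. proj j m) = m" using sum_proj by blast
    moreover have "proj j m \<in> ?R" for j
      using G_R proj_in[OF m] by (rule subsetD)
    ultimately show "m \<in> ?R" using sum_closed[OF R_0 R_add, of J "\<lambda>j. proj j m"] by simp
  qed
  ultimately show ?thesis using I b_G by blast
qed

lemma vector_space_const_poly:
  "vector_space (\<lambda>c :: 'k::field. pscale (const_poly c) :: (nat \<Rightarrow>\<^sub>0 ('v, 'k) mpoly) \<Rightarrow> _)"
proof
  note m = module_pscale
  show "pscale (const_poly a) (x + y) = pscale (const_poly a) x + pscale (const_poly a) y"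
    for a :: 'k and x y :: "nat \<Rightarrow>\<^sub>0 ('v, 'k) mpoly"
    by (rule module.scale_right_distrib[OF m])
  show "pscale (const_poly (a + b)) x = pscale (const_poly a) x + pscale (const_poly b) x"
    for a b :: 'k and x :: "nat \<Rightarrow>\<^sub>0 ('v, 'k) mpoly"
    by (simp add: const_poly_def single_add module.scale_left_distrib[OF m])
  show "pscale (const_poly a) (pscale (const_poly b) x) = pscale (const_poly (a * b)) x"
    for a b :: 'k and x :: "nat \<Rightarrow>\<^sub>0 ('v, 'k) mpoly"
    by (simp add: const_poly_def mult_single module.scale_scale[OF m])
  show "pscale (const_poly 1) x = x" for x :: "nat \<Rightarrow>\<^sub>0 ('v, 'k) mpoly"
    by (simp add: const_poly_def module.scale_one[OF m])
qed

lemma hom_part_finite_dim: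
  fixes X :: "'v set"
  assumes "finite X" "\<And>j. finite {k\<in>I. deg k = j}"
  shows "\<exists>S. finite S \<and> hom_part X I deg j
    \<subseteq> module.span (\<lambda>c :: 'k::field. pscale (const_poly c)) (S :: (nat \<Rightarrow>\<^sub>0 ('v, 'k) mpoly) set)"
proof -
  interpret K: vector_space "\<lambda>c :: 'k. pscale (const_poly c) :: (nat \<Rightarrow>\<^sub>0 ('v, 'k) mpoly) \<Rightarrow> _"
    by (rule vector_space_const_poly)
  let ?S = "(\<lambda>(k, s). Poly_Mapping.single k (Poly_Mapping.single s 1)) `
    (SIGMA k:(\<Union>i\<le>j. {k\<in>I. deg k = i}). {s :: 'v monomial. supp s \<subseteq> X \<and> mon_degree s = j - deg k})
    :: (nat \<Rightarrow>\<^sub>0 ('v, 'k) mpoly) set"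
  have "finite ?S"
    using assms finite_monomials_of_degree[OF assms(1)] by (intro finite_imageI finite_SigmaI) auto
  moreover have "hom_part X I deg j \<subseteq> K.span ?S"
  proof
    fix f :: "nat \<Rightarrow>\<^sub>0 ('v, 'k) mpoly"
    assume f: "f \<in> hom_part X I deg j"
    have "f = (\<Sum>k\<in>supp f. Poly_Mapping.single k (\<Sum>s\<in>supp (coef f k). Poly_Mapping.single s (coef (coef f k) s)))"
      by (simp add: sum_singles)
    also have "\<dots> = (\<Sum>k\<in>supp f. \<Sum>s\<in>supp (coef f k).
        pscale (const_poly (coef (coef f k) s)) (Poly_Mapping.single k (Poly_Mapping.single s 1)))"
    proof (intro sum.cong refl)
      fix k :: nat
      have "additive (Poly_Mapping.single k :: ('v, 'k) mpoly \<Rightarrow> _)"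
        by (simp add: additive_def single_add)
      then show "Poly_Mapping.single k (\<Sum>s\<in>supp (coef f k). Poly_Mapping.single s (coef (coef f k) s))
        = (\<Sum>s\<in>supp (coef f k).
          pscale (const_poly (coef (coef f k) s)) (Poly_Mapping.single k (Poly_Mapping.single s 1)))"
        by (simp add: additive.sum pscale_single const_poly_def mult_single)
    qed
    also have "\<dots> \<in> K.span ?S"
    proof (intro K.span_sum K.span_scale K.span_base)
      fix k :: nat and s :: "'v monomial"
      assume ks: "k \<in> supp f" "s \<in> supp (coef f k)"
      then have "k \<in> I" "supp s \<subseteq> X" "deg k + mon_degree s = j"
        using f by (auto simp: hom_part_def free_mod_def poly_ring_def)
      then show "Poly_Mapping.single k (Poly_Mapping.single s 1) \<in> ?S"
        by (intro image_eqI[of _ _ "(k, s)"]) auto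
    qed
    finally show "f \<in> K.span ?S" .
  qed
  ultimately show ?thesis by blast
qed

text \<open>
  The input for the next step of a resolution. Components of elements of the kernel lie in the
  kernel because homogeneous maps commute with taking components; finite-dimensionality is
  inherited from the free module, as there are finitely many monomials of each degree.
\<close>

lemma (in graded_act) kernel_graded:
  assumes X: "finite X" and I: "\<And>j. finite {k\<in>I. deg k = j}" and b: "\<And>k. k \<in> I \<Longrightarrow> b k \<in> G (deg k)"
    and Z: "Z = {f \<in> free_mod X I. lin_ext act b f = 0}"
  shows "graded_act X pscale Z (\<lambda>j. Z \<inter> hom_part X I deg j) (hcomp deg)"
proof
  have zero: "lin_ext act b 0 = 0" by (simp add: lin_ext_def)
  have act_0: "act p 0 = 0" for p using module.scale_zero_right[OF module_act] .
  have Z_pscale: "pscale p f \<in> Z" if "p \<in> poly_ring X" "f \<in> Z" for p f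
    using that by (simp add: Z lin_ext_pscale[OF module_act] free_mod_pscale act_0)
  have Z_add: "f + f' \<in> Z" if "f \<in> Z" "f' \<in> Z" for f f'
    using that by (simp add: Z lin_ext_add[OF module_act] free_mod_add)
  show "pscale (a :: ('v, 'k) mpoly) (x + y) = pscale a x + pscale a y"
    "pscale (a + a') x = pscale a x + pscale a' x"
    "pscale a (pscale a' x) = pscale (a * a') x" "pscale 1 x = x"
    for a a' and x y :: "nat \<Rightarrow>\<^sub>0 ('v, 'k) mpoly"
    using module_pscale[unfolded module_def] by blast+
  show "0 \<in> Z \<inter> hom_part X I deg j" for j by (simp add: Z zero)
  show "m + m' \<in> Z \<inter> hom_part X I deg j"
    if "m \<in> Z \<inter> hom_part X I deg j" "m' \<in> Z \<inter> hom_part X I deg j" for m m' j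
    using that by (simp add: Z_add hom_part_add)
  show "\<exists>S. finite S \<and> S \<subseteq> Z \<inter> hom_part X I deg j \<and>
      (\<forall>m\<in>Z \<inter> hom_part X I deg j. \<exists>c. m = (\<Sum>b\<in>S. pscale (const_poly (c b)) b))" for j
  proof -
    interpret K: vector_space "\<lambda>c :: 'k. pscale (const_poly c) :: (nat \<Rightarrow>\<^sub>0 ('v, 'k) mpoly) \<Rightarrow> _"
      by (rule vector_space_const_poly)
    obtain S where S: "finite S" "hom_part X I deg j \<subseteq> K.span S"
      using hom_part_finite_dim[OF X I] by blast
    obtain B where B: "B \<subseteq> Z \<inter> hom_part X I deg j" "K.independent B" "Z \<inter> hom_part X I deg j \<subseteq> K.span B"
      using K.maximal_independent_subset by metis
    have "B \<subseteq> K.span S" using B(1) S(2) by blast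
    then have "finite B" using K.independent_span_bound[OF S(1) B(2)] by blast
    moreover from B(3) have "\<forall>m\<in>Z \<inter> hom_part X I deg j. \<exists>c. m = (\<Sum>b\<in>B. pscale (const_poly (c b)) b)"
      unfolding K.span_finite[OF \<open>finite B\<close>] by blast
    ultimately show ?thesis using B(1) by blast
  qed
  show "Z \<inter> hom_part X I deg j \<subseteq> Z" for j by blast
  show "m + m' \<in> Z" if "m \<in> Z" "m' \<in> Z" for m m' using that by (rule Z_add)
  show "pscale p m \<in> Z" if "p \<in> poly_ring X" "m \<in> Z" for p m using that by (rule Z_pscale)
  show "pscale p m \<in> Z \<inter> hom_part X I deg (a + j)"
    if "p \<in> poly_ring X" "\<forall>s\<in>supp p. mon_degree s = a" "m \<in> Z \<inter> hom_part X I deg j" for p a m j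
    using that Z_pscale hom_part_pscale by blast
  show "hcomp deg j (x + y) = hcomp deg j x + hcomp deg j y" for j and x y :: "nat \<Rightarrow>\<^sub>0 ('v, 'k) mpoly"
    by (rule additive.add[OF additive_hcomp])
  show "hcomp deg j m = (m when i = j)" if "m \<in> Z \<inter> hom_part X I deg i" for m i j
    using that hcomp_id hcomp_other by (cases "i = j") auto
  show "hcomp deg j m \<in> Z \<inter> hom_part X I deg j" if "m \<in> Z" for m j
  proof -
    have m: "m \<in> free_mod X I" "lin_ext act b m = 0" using that by (auto simp: Z)
    have "lin_ext act b (hcomp deg j m) = proj j (lin_ext act b m)"
      using b m(1) by (rule lin_ext_hcomp)
    also have "\<dots> = 0" by (simp add: m(2) additive.zero[OF additive_proj])
    finally show ?thesis using hcomp_hom_part[OF m(1)] by (auto simp: Z hom_part_def)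
  qed
  show "\<exists>J. finite J \<and> (\<Sum>j\<in>J. hcomp deg j m) = m" for m :: "nat \<Rightarrow>\<^sub>0 ('v, 'k) mpoly"
    using ex_sum_hcomp by metis
qed

text \<open>
  Cover \<open>M\<close> by a free module, then the kernel of the cover by another one, and so on. A state of the
  recursion is a free module, given by \<open>I\<close> and \<open>deg\<close>, with the kernel \<open>Z\<close> that the next one has to
  cover. The first step stands apart because \<open>M\<close> is not given as a submodule of a free module.
\<close>

theorem (in graded_module) graded_free_resolution_exists:
  assumes X: "finite X"
  shows "\<exists>C. graded_free_resolution X g M G C"
proof -
  define P where "P = (\<lambda>(I, deg, Z :: (nat \<Rightarrow>\<^sub>0 ('v, 'k) mpoly) set). (\<forall>j::nat. finite {k::nat\<in>I. deg k = j}) \<and> Z \<subseteq> free_mod X I \<and>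
    graded_act X pscale Z (\<lambda>j. Z \<inter> hom_part X I deg j) (hcomp deg))"
  define Q where "Q = (\<lambda>(I, deg :: nat \<Rightarrow> nat, Z) (I' :: nat set, deg' :: nat \<Rightarrow> nat, Z'). \<exists>\<delta> :: nat \<Rightarrow> nat \<Rightarrow>\<^sub>0 ('v, 'k) mpoly.
    (\<forall>k\<in>I'. \<delta> k \<in> hom_part X I deg (deg' k)) \<and> lin_ext pscale \<delta> ` free_mod X I' = Z \<and>
    Z' = {f \<in> free_mod X I'. lin_ext pscale \<delta> f = 0})"
  obtain I0 :: "nat set" and deg0 a where cover: "(\<forall>j. finite {k\<in>I0. deg0 k = j}) \<and>
    (\<forall>k\<in>I0. a k \<in> G (deg0 k)) \<and> lin_ext (\<lambda>p m. poly_subst g p * m) a ` free_mod X I0 = M"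
    using free_cover_exists by blast
  then have I0: "\<And>j. finite {k\<in>I0. deg0 k = j}" and a: "\<And>k. k \<in> I0 \<Longrightarrow> a k \<in> G (deg0 k)"
    and M: "lin_ext (\<lambda>p m. poly_subst g p * m) a ` free_mod X I0 = M"
    by blast+
  define Z0 where "Z0 = {f \<in> free_mod X I0. lin_ext (\<lambda>p m. poly_subst g p * m) a f = 0}"
  have "P (I0, deg0, Z0)"
    using I0 kernel_graded[OF X I0 a Z0_def] by (auto simp: P_def Z0_def)
  moreover have "\<exists>t'. P t' \<and> Q t t'" if "P t" for t
  proof -
    obtain I deg Z where t: "t = (I, deg, Z)" by (cases t)
    interpret Z: graded_act X pscale Z "\<lambda>j. Z \<inter> hom_part X I deg j" "hcomp deg"
      using that by (simp add: P_def t)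
    obtain I' :: "nat set" and deg' \<delta> where cover: "(\<forall>j. finite {k\<in>I'. deg' k = j}) \<and>
      (\<forall>k\<in>I'. \<delta> k \<in> Z \<inter> hom_part X I deg (deg' k)) \<and> lin_ext pscale \<delta> ` free_mod X I' = Z"
      using Z.free_cover_exists by blast
    then have I': "\<And>j. finite {k\<in>I'. deg' k = j}"
      and \<delta>: "\<And>k. k \<in> I' \<Longrightarrow> \<delta> k \<in> Z \<inter> hom_part X I deg (deg' k)"
      and image: "lin_ext pscale \<delta> ` free_mod X I' = Z"
      by blast+
    define Z' where "Z' = {f \<in> free_mod X I'. lin_ext pscale \<delta> f = 0}"
    have "P (I', deg', Z')"
      using I' Z.kernel_graded[OF X I' \<delta> Z'_def] by (auto simp: P_def Z'_def)
    moreover have "Q t (I', deg', Z')"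
      using \<delta> image by (auto simp: Q_def t Z'_def)
    ultimately show ?thesis by blast
  qed
  ultimately obtain T where T: "\<And>n. P (T n)" "T 0 = (I0, deg0, Z0)" "\<And>n. Q (T n) (T (Suc n))"
    using dependent_nat_choice[of "\<lambda>n t. P t \<and> (n = 0 \<longrightarrow> t = (I0, deg0, Z0))" "\<lambda>_. Q"]
    by (metis nat.distinct(1))
  define I where "I n = fst (T n)" for n
  define deg where "deg n = fst (snd (T n))" for n
  define Z where "Z n = snd (snd (T n))" for n
  have T_eq: "T n = (I n, deg n, Z n)" for n by (simp add: I_def deg_def Z_def)
  have "\<forall>n. \<exists>\<delta>. (\<forall>k\<in>I (Suc n). \<delta> k \<in> hom_part X (I n) (deg n) (deg (Suc n) k)) \<and>
      lin_ext pscale \<delta> ` free_mod X (I (Suc n)) = Z n \<and>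
      Z (Suc n) = {f \<in> free_mod X (I (Suc n)). lin_ext pscale \<delta> f = 0}"
    using T(3) by (simp add: Q_def T_eq)
  from choice[OF this] obtain \<delta> where \<delta>_all: "\<forall>n.
      (\<forall>k\<in>I (Suc n). \<delta> n k \<in> hom_part X (I n) (deg n) (deg (Suc n) k)) \<and>
      lin_ext pscale (\<delta> n) ` free_mod X (I (Suc n)) = Z n \<and>
      Z (Suc n) = {f \<in> free_mod X (I (Suc n)). lin_ext pscale (\<delta> n) f = 0}"
    by blast
  have \<delta>: "\<delta> n k \<in> hom_part X (I n) (deg n) (deg (Suc n) k)" if "k \<in> I (Suc n)" for n k
    using \<delta>_all that by blast
  have image: "lin_ext pscale (\<delta> n) ` free_mod X (I (Suc n)) = Z n"
    and kernel: "Z (Suc n) = {f \<in> free_mod X (I (Suc n)). lin_ext pscale (\<delta> n) f = 0}" for n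
    using \<delta>_all[rule_format, of n] by blast+
  let ?C = "\<lparr>gbasis = I, gdeg = deg, gdiff = \<delta>, gaug = a\<rparr> :: ('v, 'x, 'k) free_complex"
  have diff: "diff_map ?C n = lin_ext pscale (\<delta> n)" for n
    by (rule ext) (simp add: diff_map_def lin_ext_def)
  have aug: "aug_map g ?C = lin_ext (\<lambda>p m. poly_subst g p * m) a"
    by (simp add: aug_map_eq_lin_ext)
  have zero: "I 0 = I0" "deg 0 = deg0" "Z 0 = Z0" using T(2) by (simp_all add: T_eq)
  have fin: "finite {k \<in> I i. deg i k = j}" for i j
    using T(1)[of i] by (simp add: P_def T_eq)
  have "graded_free_resolution X g M G ?C"
    unfolding graded_free_resolution_def diff aug
  proof (intro conjI allI ballI)
    show "finite {k \<in> gbasis ?C i. gdeg ?C i k = j}" for i j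
      using fin by simp
    show "gaug ?C k \<in> G (gdeg ?C 0 k)" if "k \<in> gbasis ?C 0" for k
      using a that by (simp add: zero)
    show "gdiff ?C i k \<in> free_mod X (gbasis ?C i)" if "k \<in> gbasis ?C (Suc i)" for i k
      using \<delta>[of k i] that by (simp add: hom_part_def)
    show "gdeg ?C i l + mon_degree s = gdeg ?C (Suc i) k"
      if "k \<in> gbasis ?C (Suc i)" "s \<in> supp (coef (gdiff ?C i k) l)" for i k l s
      using \<delta>[of k i] that by (simp add: hom_part_def)
    show "lin_ext (\<lambda>p m. poly_subst g p * m) a ` free_mod X (gbasis ?C 0) = M"
      using M by (simp add: zero)
    show "{f \<in> free_mod X (gbasis ?C 0). lin_ext (\<lambda>p m. poly_subst g p * m) a f = 0}
        = lin_ext pscale (\<delta> 0) ` free_mod X (gbasis ?C 1)"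
      using image[of 0] by (simp add: zero Z0_def)
    show "{f \<in> free_mod X (gbasis ?C (Suc i)). lin_ext pscale (\<delta> i) f = 0}
        = lin_ext pscale (\<delta> (Suc i)) ` free_mod X (gbasis ?C (Suc (Suc i)))" for i
      using image[of "Suc i"] kernel[of i] by simp
  qed
  then show ?thesis ..
qed

section \<open>Toric rings and their minimal generators\<close>

inductive_set gen_monoid :: "'x monomial set \<Rightarrow> 'x monomial set" for U where
  zero: "0 \<in> gen_monoid U"
| step: "u \<in> U \<Longrightarrow> w \<in> gen_monoid U \<Longrightarrow> u + w \<in> gen_monoid U"

lemma gen_monoid_base: "u \<in> U \<Longrightarrow> u \<in> gen_monoid U"
  using gen_monoid.step[OF _ gen_monoid.zero, of u U] by simp

lemma gen_monoid_add:
  "v \<in> gen_monoid U \<Longrightarrow> w \<in> gen_monoid U \<Longrightarrow> v + w \<in> gen_monoid U"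
  by (induction rule: gen_monoid.induct) (auto intro: gen_monoid.step simp: add.assoc)

lemma gen_monoid_mono: "U \<subseteq> V \<Longrightarrow> gen_monoid U \<subseteq> gen_monoid V"
proof
  fix w assume "U \<subseteq> V" "w \<in> gen_monoid U"
  then show "w \<in> gen_monoid V"
    by (induction rule: gen_monoid.induct[OF \<open>w \<in> gen_monoid U\<close>])
      (auto intro: gen_monoid.intros)
qed

definition monoid_algebra :: "'x monomial set \<Rightarrow> ('x, 'k::field) mpoly set"
  where "monoid_algebra N = {p. supp p \<subseteq> N}"

lemma mon_poly_in_monoid_algebra:
  "(mon_poly w :: ('x, 'k::field) mpoly) \<in> monoid_algebra N \<longleftrightarrow> w \<in> N"
  by (simp add: monoid_algebra_def mon_poly_def)

lemma monoid_algebra_inject: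
  "(monoid_algebra N :: ('x, 'k::field) mpoly set) = monoid_algebra N' \<longleftrightarrow> N = N'"
  using mon_poly_in_monoid_algebra[where 'k = 'k] by (metis subsetI subset_antisym)

lemma is_subalgebra_monoid_algebra:
  "is_subalgebra (monoid_algebra (gen_monoid U) :: ('x, 'k::field) mpoly set)"
  unfolding is_subalgebra_def
proof (intro conjI ballI subsetI)
  show "f \<in> monoid_algebra (gen_monoid U)" if "f \<in> range const_poly" for f :: "('x, 'k) mpoly"
    using that by (auto simp: monoid_algebra_def const_poly_def gen_monoid.zero split: if_splits)
  fix f g :: "('x, 'k) mpoly"
  assume fg: "f \<in> monoid_algebra (gen_monoid U)" "g \<in> monoid_algebra (gen_monoid U)"
  show "f + g \<in> monoid_algebra (gen_monoid U)"
    using fg Poly_Mapping.keys_add[of f g] by (auto simp: monoid_algebra_def)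
  show "f * g \<in> monoid_algebra (gen_monoid U)"
    using fg keys_mult[of f g] gen_monoid_add unfolding monoid_algebra_def by blast
qed

lemma is_subalgebraD:
  assumes "is_subalgebra A"
  shows "const_poly c \<in> A" "f \<in> A \<Longrightarrow> g \<in> A \<Longrightarrow> f + g \<in> A" "f \<in> A \<Longrightarrow> g \<in> A \<Longrightarrow> f * g \<in> A"
  using assms by (auto simp: is_subalgebra_def)

lemma is_subalgebra_hull: "is_subalgebra (is_subalgebra hull S)"
  by (rule hull_in) (auto simp: is_subalgebra_def)

lemma hull_mon_poly:
  "is_subalgebra hull (mon_poly ` U) = (monoid_algebra (gen_monoid U) :: ('x, 'k::field) mpoly set)"
proof
  show "is_subalgebra hull (mon_poly ` U) \<subseteq> (monoid_algebra (gen_monoid U) :: ('x, 'k) mpoly set)"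
    by (rule hull_minimal)
      (auto simp: mon_poly_in_monoid_algebra gen_monoid_base is_subalgebra_monoid_algebra)
  let ?H = "is_subalgebra hull (mon_poly ` U) :: ('x, 'k) mpoly set"
  note const = is_subalgebraD(1)[OF is_subalgebra_hull]
  note closed = is_subalgebraD(2,3)[OF is_subalgebra_hull]
  have mon: "mon_poly w \<in> ?H" if "w \<in> gen_monoid U" for w
    using that
  proof (induction rule: gen_monoid.induct)
    case zero
    then show ?case using const[of 1 "mon_poly ` U"] by (simp add: const_poly_def mon_poly_def)
  next
    case (step u w)
    have "mon_poly u \<in> ?H" using step.hyps(1) by (intro hull_inc) blast
    then show ?case unfolding mon_poly_add using step.IH by (rule closed(2))
  qed
  show "monoid_algebra (gen_monoid U) \<subseteq> ?H"
  proof
    fix p :: "('x, 'k) mpoly"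
    assume p: "p \<in> monoid_algebra (gen_monoid U)"
    have "(\<Sum>w\<in>supp p. const_poly (coef p w) * mon_poly w) \<in> ?H"
    proof (rule sum_closed[OF _ closed(1)])
      show "0 \<in> ?H" using const[of 0 "mon_poly ` U"] by (simp add: const_poly_def)
      show "const_poly (coef p w) * mon_poly w \<in> ?H" if "w \<in> supp p" for w
        using p that by (intro closed(2) const mon) (auto simp: monoid_algebra_def)
    qed
    then show "p \<in> ?H"
      by (simp add: const_poly_def mon_poly_def mult_single sum_singles)
  qed
qed

lemma minimally_generates_iff:
  "minimally_generates U A \<longleftrightarrow>
    A = monoid_algebra (gen_monoid U) \<and> (\<forall>V. V \<subset> U \<longrightarrow> gen_monoid V \<noteq> gen_monoid U)"
proof (cases "A = monoid_algebra (gen_monoid U)")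
  case True
  show ?thesis
    unfolding True minimally_generates_def hull_mon_poly monoid_algebra_inject by simp
next
  case False
  then show ?thesis unfolding minimally_generates_def hull_mon_poly by simp
qed

definition atoms :: "'x monomial set \<Rightarrow> 'x monomial set"
  where "atoms N = {a \<in> N. a \<noteq> 0 \<and> (\<forall>b\<in>N. \<forall>c\<in>N. a = b + c \<longrightarrow> b = 0 \<or> c = 0)}"

lemma atoms_subset: "atoms (gen_monoid U) \<subseteq> U"
proof
  fix a
  assume "a \<in> atoms (gen_monoid U)"
  then have a: "a \<in> gen_monoid U" "a \<noteq> 0"
    and split: "\<And>b c. b \<in> gen_monoid U \<Longrightarrow> c \<in> gen_monoid U \<Longrightarrow> a = b + c \<Longrightarrow> b = 0 \<or> c = 0"
    by (auto simp: atoms_def)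
  have "w \<in> U" if "w \<in> gen_monoid U" "w = a" for w
    using that
  proof (induction rule: gen_monoid.induct)
    case zero
    then show ?case using a by simp
  next
    case (step u w)
    then have "u = 0 \<or> w = 0" using split[of u w] by (simp add: gen_monoid_base)
    then show ?case using step by auto
  qed
  then show "a \<in> U" using a by blast
qed

lemma gen_monoid_atoms: "gen_monoid (atoms (gen_monoid U)) = gen_monoid U"
proof
  show "gen_monoid (atoms (gen_monoid U)) \<subseteq> gen_monoid U"
    by (rule gen_monoid_mono[OF atoms_subset])
  show "gen_monoid U \<subseteq> gen_monoid (atoms (gen_monoid U))"
  proof
    fix w
    assume "w \<in> gen_monoid U"
    then show "w \<in> gen_monoid (atoms (gen_monoid U))"
    proof (induction w rule: measure_induct_rule[of mon_degree])
      case (less w)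
      consider "w = 0" | "w \<in> atoms (gen_monoid U)"
        | b c where "b \<in> gen_monoid U" "c \<in> gen_monoid U" "w = b + c" "b \<noteq> 0" "c \<noteq> 0"
        using less.prems by (auto simp: atoms_def)
      then show ?case
      proof cases
        case 1
        then show ?thesis by (simp add: gen_monoid.zero)
      next
        case 2
        then show ?thesis by (rule gen_monoid_base)
      next
        case 3
        then have "mon_degree b < mon_degree w" "mon_degree c < mon_degree w"
          by (simp_all add: neq0_conv[symmetric] del: neq0_conv)
        with 3 less.IH show ?thesis by (simp add: gen_monoid_add)
      qed
    qed
  qed
qed

text \<open>
  The irreducible elements of a monoid of monomials generate it, by induction on the degree, and
  lie in every generating set; so they are the only minimal generating set.
\<close>

lemma minimally_generates_unique:
  assumes "minimally_generates U A" "minimally_generates V A"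
  shows "U = V"
proof -
  have atoms: "W = atoms (gen_monoid W)" if "minimally_generates W A" for W
    using that atoms_subset[of W] gen_monoid_atoms[of W] unfolding minimally_generates_iff by blast
  have "gen_monoid U = gen_monoid V"
    using assms by (metis minimally_generates_iff monoid_algebra_inject)
  then show ?thesis using atoms assms by metis
qed

lemma min_gens_eq: "finite U \<Longrightarrow> minimally_generates U A \<Longrightarrow> min_gens A = U"
  unfolding min_gens_def by (rule the_equality) (auto dest: minimally_generates_unique)

section \<open>Generators of equal degree\<close>

text \<open>The projections recover the components from the sum.\<close>

lemma (in graded_act) unique_decomposition:
  assumes m: "m \<in> M"
  shows "\<exists>!h :: nat \<Rightarrow>\<^sub>0 'm. (\<forall>j. coef h j \<in> G j) \<and> m = (\<Sum>j\<in>supp h. coef h j)"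
proof -
  obtain J where J: "finite J" "(\<Sum>j\<in>J. proj j m) = m" using sum_proj[OF m] by blast
  define h where "h = (\<Sum>j\<in>J. Poly_Mapping.single j (proj j m))"
  have h: "coef h j = (proj j m when j \<in> J)" for j
    using J(1) by (simp add: h_def lookup_sum lookup_single when_def)
  have "(\<Sum>j\<in>supp h. coef h j) = (\<Sum>j\<in>J. coef h j)"
    using J(1) by (intro sum.mono_neutral_left) (auto simp: in_keys_iff h)
  also have "\<dots> = m" using J(2) by (simp add: h)
  finally have h_sum: "m = (\<Sum>j\<in>supp h. coef h j)" ..
  have h_G: "coef h j \<in> G j" for j using proj_in[OF m] G_0 by (simp add: h when_def)
  have determined: "coef h' j = proj j m"
    if "\<forall>j. coef h' j \<in> G j" "m = (\<Sum>j\<in>supp h'. coef h' j)" for h' j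
  proof -
    have "proj j m = (\<Sum>i\<in>supp h'. proj j (coef h' i))"
      by (subst that(2)) (simp only: additive.sum[OF additive_proj])
    also have "\<dots> = (\<Sum>i\<in>supp h'. coef h' i when i = j)"
      using that(1) by (intro sum.cong refl proj_G) blast
    also have "\<dots> = coef h' j"
      by (cases "j \<in> supp h'") (auto simp: when_def in_keys_iff)
    finally show ?thesis ..
  qed
  show ?thesis
  proof (rule ex1I[of _ h])
    show "(\<forall>j. coef h j \<in> G j) \<and> m = (\<Sum>j\<in>supp h. coef h j)" using h_G h_sum by blast
    fix h'
    assume h': "(\<forall>j. coef h' j \<in> G j) \<and> m = (\<Sum>j\<in>supp h'. coef h' j)"
    have "coef h' j = proj j m" for j by (rule determined[OF conjunct1[OF h'] conjunct2[OF h']])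
    moreover have "coef h j = proj j m" for j by (rule determined[OF _ h_sum]) (simp add: h_G)
    ultimately show "h' = h" by (intro poly_mapping_eqI) (rule trans[OF _ sym])
  qed
qed

lemma poly_subst_eq_sum:
  "poly_subst mon_poly p = (\<Sum>s\<in>supp p. Poly_Mapping.single (expand s) (coef p s :: 'k::field))"
proof -
  have "poly_subst mon_poly (\<Sum>s\<in>supp p. Poly_Mapping.single s (coef p s))
      = (\<Sum>s\<in>supp p. Poly_Mapping.single (expand s) (coef p s))"
    by (simp only: additive.sum[OF additive_poly_subst] poly_subst_single)
  then show ?thesis by (simp add: sum_singles)
qed

lemma supp_poly_subst:
  "supp (poly_subst mon_poly p :: ('x, 'k::field) mpoly) \<subseteq> expand ` supp p"
proof -
  have "supp (poly_subst mon_poly p :: ('x, 'k) mpoly)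
      \<subseteq> (\<Union>s\<in>supp p. supp (Poly_Mapping.single (expand s) (coef p s)))"
    unfolding poly_subst_eq_sum by (rule keys_sum)
  also have "\<dots> \<subseteq> expand ` supp p" by (auto split: if_splits)
  finally show ?thesis .
qed

lemma poly_subst_const: "poly_subst mon_poly (const_poly c) = (const_poly c :: ('x, 'k::field) mpoly)"
proof -
  have "expand 0 = (0 :: 'x monomial)" by (simp add: expand_def)
  then show ?thesis by (simp add: const_poly_def poly_subst_single)
qed

lemma expand_gen_monoid:
  assumes "supp s \<subseteq> U"
  shows "expand s \<in> gen_monoid U"
  unfolding expand_def
proof (rule sum_closed[OF gen_monoid.zero gen_monoid_add])
  fix u
  assume "u \<in> supp s"
  with assms have u: "u \<in> U" by blast
  show "pscale (coef s u) u \<in> gen_monoid U"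
  proof (induction "coef s u" arbitrary: s)
    case 0
    have "pscale 0 u = 0" by (rule poly_mapping_eqI) (simp add: lookup_pscale)
    then show ?case by (metis 0 gen_monoid.zero)
  next
    case (Suc m)
    have "pscale (Suc m) u = u + pscale m u"
      by (rule poly_mapping_eqI) (simp add: lookup_pscale lookup_add)
    moreover have "pscale m u \<in> gen_monoid U"
      using Suc(1)[of "Poly_Mapping.single u m"] by simp
    ultimately show ?case using u Suc(2) by (metis gen_monoid.step)
  qed
qed

locale equal_degree_toric =
  fixes U :: "'x monomial set" and d :: nat and A :: "('x, 'k::field) mpoly set"
  assumes finite_U: "finite U" and d_pos: "d \<ge> 1" and degree_U: "u \<in> U \<Longrightarrow> mon_degree u = d"
    and A_eq: "A = monoid_algebra (gen_monoid U)"
begin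

lemma degree_dvd: "w \<in> gen_monoid U \<Longrightarrow> d dvd mon_degree w"
  by (induction rule: gen_monoid.induct) (auto simp: degree_U)

lemma degree_d_in_U:
  assumes "w \<in> gen_monoid U" "mon_degree w = d"
  shows "w \<in> U"
  using assms by (cases rule: gen_monoid.cases) (use d_pos degree_U in auto)

text \<open>
  Omitting a generator \<open>u\<close> loses it: an element of degree \<open>d \<ge> 1\<close> of the monoid generated by the
  others is one of the others, since a sum of two or more of them has degree at least \<open>2 d\<close>.
\<close>

lemma minimally_generates: "minimally_generates U A"
  unfolding minimally_generates_iff
proof (intro conjI allI impI A_eq notI)
  fix V
  assume V: "V \<subset> U" "gen_monoid V = gen_monoid U"
  then obtain u where u: "u \<in> U" "u \<notin> V" by blast
  interpret V: equal_degree_toric V d "monoid_algebra (gen_monoid V) :: ('x, 'k) mpoly set"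
    using V(1) finite_U d_pos degree_U by unfold_locales (auto intro: finite_subset)
  show False using V.degree_d_in_U[of u] V(2) u degree_U by (simp add: gen_monoid_base)
qed

lemma min_gens: "min_gens A = U"
  using finite_U minimally_generates by (rule min_gens_eq)

lemma toric_grading_iff:
  "f \<in> toric_grading d A j \<longleftrightarrow> supp f \<subseteq> {w \<in> gen_monoid U. mon_degree w = d * j}"
  by (auto simp: toric_grading_def A_eq monoid_algebra_def)

lemma finite_degree_part: "finite {w \<in> gen_monoid U. mon_degree w = m}"
proof (rule finite_subset)
  have "supp w \<subseteq> (\<Union>u\<in>U. supp u)" if "w \<in> gen_monoid U" for w
    using that by (induction rule: gen_monoid.induct) (auto simp: supp_add_monomial)
  then show "{w \<in> gen_monoid U. mon_degree w = m}
      \<subseteq> {w. supp w \<subseteq> (\<Union>u\<in>U. supp u) \<and> mon_degree w = m}" by blast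
  show "finite {w :: 'x monomial. supp w \<subseteq> (\<Union>u\<in>U. supp u) \<and> mon_degree w = m}"
    using finite_U by (intro finite_monomials_of_degree) auto
qed

lemma A_closed: "f \<in> A \<Longrightarrow> g \<in> A \<Longrightarrow> f + g \<in> A" "f \<in> A \<Longrightarrow> g \<in> A \<Longrightarrow> f * g \<in> A"
  unfolding A_eq by (fact is_subalgebraD(2,3)[OF is_subalgebra_monoid_algebra])+

lemma toric_grading_mult:
  assumes "f \<in> toric_grading d A i" "g \<in> toric_grading d A j"
  shows "f * g \<in> toric_grading d A (i + j)"
  unfolding toric_grading_iff
proof
  fix w
  assume "w \<in> supp (f * g)"
  then obtain a b where "a \<in> supp f" "b \<in> supp g" "w = a + b"
    using keys_mult[of f g] by blast
  moreover from this have "a \<in> {w \<in> gen_monoid U. mon_degree w = d * i}"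
    "b \<in> {w \<in> gen_monoid U. mon_degree w = d * j}"
    using assms unfolding toric_grading_iff by blast+
  ultimately show "w \<in> {w \<in> gen_monoid U. mon_degree w = d * (i + j)}"
    by (simp add: gen_monoid_add algebra_simps)
qed

lemma poly_subst_toric_grading:
  assumes "p \<in> poly_ring U" "\<forall>s\<in>supp p. mon_degree s = a"
  shows "(poly_subst mon_poly p :: ('x, 'k) mpoly) \<in> toric_grading d A a"
  unfolding toric_grading_iff
proof
  fix w
  assume "w \<in> supp (poly_subst mon_poly p :: ('x, 'k) mpoly)"
  then obtain s where s: "s \<in> supp p" "w = expand s" using supp_poly_subst by blast
  then have sU: "supp s \<subseteq> U" using assms(1) by (simp add: poly_ring_def)
  then have "mon_degree w = d * mon_degree s"
    unfolding s(2) using degree_U by (intro mon_degree_expand) blast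
  then show "w \<in> {w \<in> gen_monoid U. mon_degree w = d * a}"
    using s sU assms(2) by (simp add: expand_gen_monoid)
qed

lemma graded_module:
  "graded_module U mon_poly A (toric_grading d A) (\<lambda>j. restrict {w. mon_degree w = d * j})"
  unfolding graded_module_def
proof
  show "poly_subst mon_poly a * (x + y) = poly_subst mon_poly a * x + (poly_subst mon_poly a * y :: ('x, 'k) mpoly)"
    "poly_subst mon_poly (a + b) * x = poly_subst mon_poly a * x + (poly_subst mon_poly b * x :: ('x, 'k) mpoly)"
    "poly_subst mon_poly a * (poly_subst mon_poly b * x) = (poly_subst mon_poly (a * b) * x :: ('x, 'k) mpoly)"
    "poly_subst mon_poly 1 * x = (x :: ('x, 'k) mpoly)" for a b x y
    using module_poly_subst[unfolded module_def] by blast+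
  show "0 \<in> toric_grading d A j" for j by (simp add: toric_grading_iff)
  show "m + m' \<in> toric_grading d A j"
    if "m \<in> toric_grading d A j" "m' \<in> toric_grading d A j" for m m' j
    using that Poly_Mapping.keys_add[of m m'] by (auto simp: toric_grading_iff)
  show "\<exists>S. finite S \<and> S \<subseteq> toric_grading d A j \<and> (\<forall>m\<in>toric_grading d A j.
      \<exists>c. m = (\<Sum>b\<in>S. poly_subst mon_poly (const_poly (c b)) * b))" for j
  proof (intro exI[of _ "mon_poly ` {w \<in> gen_monoid U. mon_degree w = d * j}"] conjI ballI)
    let ?W = "{w \<in> gen_monoid U. mon_degree w = d * j}"
    let ?mon = "mon_poly :: 'x monomial \<Rightarrow> ('x, 'k) mpoly"
    have inj: "inj_on ?mon ?W"
      by (rule inj_onI) (metis mon_poly_def keys_single zero_neq_one the_elem_eq)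
    show "finite (?mon ` ?W)" using finite_degree_part by blast
    show "?mon ` ?W \<subseteq> toric_grading d A j"
      by (auto simp: toric_grading_iff mon_poly_def)
    fix m
    assume m: "m \<in> toric_grading d A j"
    let ?c = "\<lambda>b. coef m (the_inv_into ?W ?mon b)"
    have "(\<Sum>b\<in>?mon ` ?W. poly_subst mon_poly (const_poly (?c b)) * b)
        = (\<Sum>w\<in>?W. Poly_Mapping.single w (coef m w))"
      using inj by (simp add: sum.reindex poly_subst_const the_inv_into_f_f)
        (simp add: const_poly_def mon_poly_def mult_single)
    also have "\<dots> = (\<Sum>w\<in>supp m. Poly_Mapping.single w (coef m w))"
      using m finite_degree_part
      by (intro sum.mono_neutral_right) (auto simp: toric_grading_iff in_keys_iff)
    finally show "\<exists>c. m = (\<Sum>b\<in>?mon ` ?W. poly_subst mon_poly (const_poly (c b)) * b)"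
      by (intro exI[of _ ?c]) (simp add: sum_singles)
  qed
  show "toric_grading d A j \<subseteq> A" for j by (auto simp: toric_grading_def)
  show "m + m' \<in> A" if "m \<in> A" "m' \<in> A" for m m' using that by (rule A_closed)
  show "poly_subst mon_poly p * m \<in> A" if "p \<in> poly_ring U" "m \<in> A" for p m
  proof (rule A_closed(2)[OF _ that(2)])
    have "supp s \<subseteq> U" if "s \<in> supp p" for s
      using \<open>p \<in> poly_ring U\<close> that by (simp add: poly_ring_def)
    then show "poly_subst mon_poly p \<in> A"
      using supp_poly_subst[of p] expand_gen_monoid
      unfolding A_eq monoid_algebra_def by blast
  qed
  show "poly_subst mon_poly p * m \<in> toric_grading d A (a + j)"
    if "p \<in> poly_ring U" "\<forall>s\<in>supp p. mon_degree s = a" "m \<in> toric_grading d A j" for p a m j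
    using poly_subst_toric_grading[OF that(1,2)] that(3) by (rule toric_grading_mult)
  show "restrict {w. mon_degree w = d * j} (x + y)
      = restrict {w. mon_degree w = d * j} x + restrict {w. mon_degree w = d * j} y"
    for j and x y :: "('x, 'k) mpoly"
    by (rule additive.add[OF additive_restrict])
  show "restrict {w. mon_degree w = d * j} m = (m when i = j)"
    if "m \<in> toric_grading d A i" for m i j
  proof (cases "i = j")
    case True
    then show ?thesis using that by (auto simp: toric_grading_iff intro: restrict_id)
  next
    case False
    then show ?thesis using that d_pos by (auto simp: toric_grading_iff intro!: restrict_eq_0)
  qed
  show "restrict {w. mon_degree w = d * j} m \<in> toric_grading d A j" if "m \<in> A" for m j
    using that unfolding toric_grading_iff supp_restrict by (auto simp: A_eq monoid_algebra_def)
  show "\<exists>J. finite J \<and> (\<Sum>j\<in>J. restrict {w. mon_degree w = d * j} m) = m" if m: "m \<in> A" for m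
  proof (intro exI[of _ "(\<lambda>w. mon_degree w div d) ` supp m"] conjI)
    show "(\<Sum>j\<in>(\<lambda>w. mon_degree w div d) ` supp m. restrict {w. mon_degree w = d * j} m) = m"
    proof (rule poly_mapping_eqI)
      fix w
      let ?J = "(\<lambda>w. mon_degree w div d) ` supp m"
      show "coef (\<Sum>j\<in>?J. restrict {w. mon_degree w = d * j} m) w = coef m w"
      proof (cases "w \<in> supp m")
        case True
        then have "d dvd mon_degree w"
          using m degree_dvd by (auto simp: A_eq monoid_algebra_def)
        then have eq: "mon_degree w = d * j \<longleftrightarrow> mon_degree w div d = j" for j
          using d_pos by auto
        show ?thesis using True
          by (simp add: lookup_sum lookup_restrict when_def eq)
      next
        case False
        then show ?thesis by (simp add: lookup_sum lookup_restrict when_def in_keys_iff)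
      qed
    qed
  qed simp
qed

lemma subspace_toric_grading: "module.subspace pscale (toric_grading d A j)"
  using Poly_Mapping.keys_add supp_pscale
  by (fastforce simp: module.subspace_def[OF module_pscale] toric_grading_iff)

lemma toric_grading_1_span: "toric_grading d A 1 = module.span pscale (mon_poly ` U)"
proof
  show "module.span pscale (mon_poly ` U) \<subseteq> toric_grading d A 1"
    by (rule module.span_minimal[OF module_pscale _ subspace_toric_grading])
      (auto simp: toric_grading_iff mon_poly_def gen_monoid_base degree_U)
  show "toric_grading d A 1 \<subseteq> module.span pscale (mon_poly ` U)"
  proof
    fix f
    assume f: "f \<in> toric_grading d A 1"
    have "(\<Sum>w\<in>supp f. pscale (coef f w) (mon_poly w)) \<in> module.span pscale (mon_poly ` U)"
      using f degree_d_in_U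
      by (intro module.span_sum[OF module_pscale] module.span_scale[OF module_pscale]
          module.span_base[OF module_pscale] imageI) (auto simp: toric_grading_iff)
    then show "f \<in> module.span pscale (mon_poly ` U)"
      by (simp add: mon_poly_def pscale_single sum_singles)
  qed
qed

lemma standard_graded: "standard_graded A (toric_grading d A)"
  unfolding standard_graded_def
proof (intro conjI allI ballI)
  interpret graded_module U mon_poly A "toric_grading d A" "\<lambda>j. restrict {w. mon_degree w = d * j}"
    by (rule graded_module)
  show sub: "is_subalgebra A" by (simp add: A_eq is_subalgebra_monoid_algebra)
  show "module.subspace pscale (toric_grading d A j)" for j by (rule subspace_toric_grading)
  show "toric_grading d A j \<subseteq> A" for j by (rule G_subset)
  show "\<exists>!h. (\<forall>j. coef h j \<in> toric_grading d A j) \<and> f = (\<Sum>j\<in>supp h. coef h j)" if "f \<in> A" for f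
    using that by (rule unique_decomposition)
  show "f * g \<in> toric_grading d A (i + j)"
    if "f \<in> toric_grading d A i" "g \<in> toric_grading d A j" for i j f g
    using that by (rule toric_grading_mult)
  show "toric_grading d A 0 = range const_poly"
  proof
    show "toric_grading d A 0 \<subseteq> range const_poly"
    proof
      fix f
      assume "f \<in> toric_grading d A 0"
      then have "supp f \<subseteq> {0}" by (auto simp: toric_grading_iff)
      then have "f = const_poly (coef f 0)"
        by (intro poly_mapping_eqI) (auto simp: const_poly_def lookup_single when_def in_keys_iff)
      then show "f \<in> range const_poly" by blast
    qed
    show "range const_poly \<subseteq> toric_grading d A 0"
      by (auto simp: toric_grading_iff const_poly_def gen_monoid.zero)
  qed
  show "\<exists>S. finite S \<and> toric_grading d A 1 = module.span pscale S"
    using finite_U toric_grading_1_span by blast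
  show "is_subalgebra hull toric_grading d A 1 = A"
  proof
    show "is_subalgebra hull toric_grading d A 1 \<subseteq> A"
      by (rule hull_minimal[where S = is_subalgebra, OF G_subset sub])
    have "mon_poly ` U \<subseteq> toric_grading d A 1"
      by (auto simp: toric_grading_iff mon_poly_def gen_monoid_base degree_U)
    then show "A \<subseteq> is_subalgebra hull toric_grading d A 1"
      unfolding A_eq hull_mon_poly[symmetric] by (rule hull_mono)
  qed
qed

end

section \<open>Betti numbers of combinatorial pure subrings\<close>

text \<open>
  A sum of generators is supported in \<open>T\<close> only if each of its terms is. So the monomials of a
  combinatorial pure subring are generated by generators of the toric ring.
\<close>

lemma gen_monoid_face:
  "gen_monoid U \<inter> {w. supp w \<subseteq> T} = gen_monoid {u \<in> U. supp u \<subseteq> T}"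
proof
  have "w \<in> gen_monoid {u \<in> U. supp u \<subseteq> T}" if "w \<in> gen_monoid U" "supp w \<subseteq> T" for w
    using that by (induction rule: gen_monoid.induct)
      (auto simp: supp_add_monomial intro: gen_monoid.intros)
  then show "gen_monoid U \<inter> {w. supp w \<subseteq> T} \<subseteq> gen_monoid {u \<in> U. supp u \<subseteq> T}" by blast
  have "supp w \<subseteq> T" if "w \<in> gen_monoid {u \<in> U. supp u \<subseteq> T}" for w
    using that by (induction rule: gen_monoid.induct) (auto simp: supp_add_monomial)
  moreover have "gen_monoid {u \<in> U. supp u \<subseteq> T} \<subseteq> gen_monoid U"
    by (rule gen_monoid_mono) blast
  ultimately show "gen_monoid {u \<in> U. supp u \<subseteq> T} \<subseteq> gen_monoid U \<inter> {w. supp w \<subseteq> T}" by blast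
qed

text \<open>
  The image of a monomial \<open>t\<^sup>s\<close> involves only variables from \<open>T\<close> exactly if every \<open>u\<close> occurring in
  \<open>s\<close> does, so the two retractions commute with the substitution \<open>t\<^sub>u \<mapsto> u\<close>.
\<close>

lemma restrict_poly_subst:
  fixes p :: "('x monomial, 'k::field) mpoly"
  assumes p: "p \<in> poly_ring U" and V: "V = {u \<in> U. supp u \<subseteq> T}"
  shows "restrict {w. supp w \<subseteq> T} (poly_subst mon_poly p :: ('x, 'k) mpoly)
    = poly_subst mon_poly (restrict {s. supp s \<subseteq> V} p)"
proof -
  have iff: "supp (expand s) \<subseteq> T \<longleftrightarrow> supp s \<subseteq> V" if "s \<in> supp p" for s
    using that p by (auto simp: supp_expand V poly_ring_def)
  let ?q = "restrict {s. supp s \<subseteq> V} p"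
  have "restrict {w. supp w \<subseteq> T} (poly_subst mon_poly p)
      = (\<Sum>s\<in>supp p. Poly_Mapping.single (expand s) (coef p s) when supp (expand s) \<subseteq> T)"
    by (simp add: poly_subst_eq_sum additive.sum[OF additive_restrict] restrict_single)
  also have "\<dots> = (\<Sum>s\<in>supp p. Poly_Mapping.single (expand s) (coef ?q s))"
    by (intro sum.cong refl) (simp add: iff lookup_restrict when_def)
  also have "\<dots> = (\<Sum>s\<in>supp ?q. Poly_Mapping.single (expand s) (coef ?q s))"
    by (rule sum.mono_neutral_right) (auto simp: supp_restrict lookup_restrict)
  finally show ?thesis by (simp add: poly_subst_eq_sum)
qed

theorem corollary1p3:
  fixes n d :: nat and A B :: "(nat, 'k::field) mpoly set"
  assumes "toric_ring n A"
    and "d \<ge> 1"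
    and "\<forall>u\<in>min_gens A. mon_degree u = d"
    and "combinatorial_pure_subring n A B"
  shows "standard_graded A (toric_grading d A) \<and>
    standard_graded B (toric_grading d B) \<and>
    (\<forall>i j. betti d B i j \<le> betti d A i j)"
proof -
  obtain U where U: "finite U" "minimally_generates U A"
    using assms(1) by (auto simp: toric_ring_def)
  have gens_A: "min_gens A = U" using U by (rule min_gens_eq)
  obtain T where B: "B = A \<inter> poly_ring T"
    using assms(4) by (auto simp: combinatorial_pure_subring_def)
  define V where "V = {u \<in> U. supp u \<subseteq> T}"
  interpret A: equal_degree_toric U d A
    using U assms(2,3) gens_A by unfold_locales (auto simp: minimally_generates_iff)
  have "B = monoid_algebra (gen_monoid V)"
    unfolding B A.A_eq V_def gen_monoid_face[symmetric]
    by (auto simp: monoid_algebra_def poly_ring_def)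
  then interpret B: equal_degree_toric V d B
    using U(1) assms(2) A.degree_U by unfold_locales (auto simp: V_def)
  have "betti d B i j \<le> betti d A i j" for i j
  proof -
    define C where "C = (SOME C :: (nat monomial, nat, 'k) free_complex.
      graded_free_resolution U mon_poly A (toric_grading d A) C)"
    define C' where "C' = (SOME C :: (nat monomial, nat, 'k) free_complex.
      graded_free_resolution V mon_poly B (toric_grading d B) C)"
    have C: "graded_free_resolution U mon_poly A (toric_grading d A) C"
      unfolding C_def
      by (rule someI_ex[OF graded_module.graded_free_resolution_exists[OF A.graded_module A.finite_U]])
    have C': "graded_free_resolution V mon_poly B (toric_grading d B) C'"
      unfolding C'_def
      by (rule someI_ex[OF graded_module.graded_free_resolution_exists[OF B.graded_module B.finite_U]])
    let ?F = "{s :: nat monomial monomial. supp s \<subseteq> V}"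
    let ?\<pi> = "restrict {w. supp w \<subseteq> T} :: (nat, 'k) mpoly \<Rightarrow> _"
    have "vector_space.dim pscale (tor_cycles C' i j) - vector_space.dim pscale (tor_boundaries C' i j)
      \<le> vector_space.dim pscale (tor_cycles C i j) - vector_space.dim pscale (tor_boundaries C i j)"
    proof (rule tor_dim_le_of_retract[OF B.graded_module A.graded_module C C',
          where F = ?F and \<iota> = "\<lambda>m. m" and \<pi> = ?\<pi>])
      show "face ?F" by (rule face_monomials)
      show "restrict ?F p \<in> poly_ring V" for p :: "(nat monomial, 'k) mpoly"
        by (auto simp: poly_ring_def supp_restrict)
      show "restrict ?F p \<in> poly_ring U" for p :: "(nat monomial, 'k) mpoly"
        by (auto simp: poly_ring_def supp_restrict V_def)
      show "additive (\<lambda>m :: (nat, 'k) mpoly. m)" by (simp add: additive_def)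
      show "m \<in> toric_grading d A j" if "m \<in> toric_grading d B j" for m j
        using that by (auto simp: toric_grading_def B)
      show "poly_subst mon_poly p * m = poly_subst mon_poly (restrict ?F p) * m"
        if "p \<in> poly_ring V" for p and m :: "(nat, 'k) mpoly"
        using that by (subst restrict_id) (auto simp: poly_ring_def)
      show "additive ?\<pi>" by (rule additive_restrict)
      show "?\<pi> m \<in> toric_grading d B j" if "m \<in> toric_grading d A j" for m j
        using that by (auto simp: A.toric_grading_iff B.toric_grading_iff supp_restrict V_def
            simp flip: gen_monoid_face)
      show "?\<pi> (poly_subst mon_poly p * m) = poly_subst mon_poly (restrict ?F p) * ?\<pi> m"
        if "p \<in> poly_ring U" for p m
        by (simp add: restrict_mult[OF face_monomials] restrict_poly_subst[OF that V_def])
      show "?\<pi> m = m" if "m \<in> B" for m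
        using that by (intro restrict_id) (auto simp: B poly_ring_def)
    qed simp
    then show ?thesis
      by (simp add: betti_def tor_dim_def A.min_gens B.min_gens Let_def flip: C_def C'_def)
  qed
  then show ?thesis using A.standard_graded B.standard_graded by blast
qed

end
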